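(* Let $0<\varepsilon\le 1/d$ and $\mathcal{Y}=[\varepsilon,1]^d\cap\Delta_{d-1}$, where $\Delta_{d-1}=\{p\in\mathbb{R}^d: p_i\ge 0,\ \sum_{i=1}^d p_i=1\}$. Consider an adaptive random scan Gibbs sampler (AdapRSG) for $\pi$ whose selection probabilities satisfy $\alpha_n\in\mathcal{Y}$ for all $n$. Assume that (a) $|\alpha_n-\alpha_{n-1}|\to 0$ in probability for fixed starting values $x_0\in\mathcal{X}$ and $\alpha_0\in\mathcal{Y}$; (b) there exists $\beta\in\mathcal{Y}$ such that the (non-adaptive) random scan Gibbs sampler RSG($\beta$) is uniformly ergodic. Then AdapRSG is ergodic, i.e. $T(x_0,\alpha_0,n)\to 0$ as $n\to\infty$. Moreover, if (a') $\sup_{x_0,\alpha_0}|\alpha_n-\alpha_{n-1}|\to 0$ in probability (supremum over all starting values $x_0\in\mathcal{X}$, $\alpha_0\in\mathcal{Y}$), then the convergence of AdapRSG is also uniform over all $x_0,\alpha_0$, i.e. $\sup_{x_0,\alpha_0}T(x_0,\alpha_0,n)\to 0$ as $n\to\infty$.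
   Context: Setting: $(\mathcal{X},\mathcal{B}(\mathcal{X}))$ is a $d$-dimensional state space with $\mathcal{X}=\mathcal{X}_1\times\dots\times\mathcal{X}_d$, and $\pi$ is a probability measure on it. For $x\in\mathcal{X}$, $x_{-i}$ denotes $x$ with the $i$-th coordinate removed, and $\pi(\cdot\,|\,x_{-i})$ is the conditional distribution of $Z_i$ given $Z_{-i}=x_{-i}$, where $Z\sim\pi$. RSG($\alpha$): for selection probabilities $\alpha=(\alpha_1,\dots,\alpha_d)$, the Markov chain with kernel $P_\alpha$ which from $x$ chooses a coordinate $i$ with probability $\alpha_i$, draws $Y\sim\pi(\cdot\,|\,x_{-i})$, and replaces the $i$-th coordinate of $x$ by $Y$. AdapRSG: given $X_0=x_0$ and $\alpha_0$, for $n\ge1$ set $\alpha_n:=R_n(\alpha_{n-1},X_{n-1},\dots,X_0)\in\mathcal{Y}$, where $R_n$ is some update rule; then choose a coordinate $i$ according to the selection probabilities $\alpha_n$, draw $Y\sim\pi(\cdot\,|\,X_{n-1,-i})$, and let $X_n$ be $X_{n-1}$ with its $i$-th coordinate replaced by $Y$. $\pi_n(x_0,\alpha_0)$ is the distribution of $X_n$ given $X_0=x_0$ and $\alpha_0$, and $T(x_0,\alpha_0,n):=\|\pi_n(x_0,\alpha_0)-\pi\|_{TV}$ (total variation distance). A kernel $P$ with stationary distribution $\pi$ is uniformly ergodic if there are $M<\infty$, $\rho<1$ with $\|P^n(x,\cdot)-\pi\|_{TV}\le M\rho^n$ for all $x\in\mathcal{X}$ and all $n$. $|\cdot|$ is a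 norm on $\mathbb{R}^d$ (all norms being equivalent, the choice is immaterial). *)

theory Defs
  imports "HOL-Probability.Probability"
begin

text \<open>
  The finite type \<open>'d\<close> indexes the coordinates, so the dimension is \<open>d = CARD('d)\<close>. The factors
  \<open>X_i\<close> are the measurable spaces \<open>M i\<close>, which may have different carriers, and the
  state space is \<open>PiM UNIV M\<close>. The point \<open>x_{-i}\<close> is \<open>restrict x (- {i})\<close>.
\<close>

definition sel_simplex :: "(real^'d) set" where
  "sel_simplex = {p. (\<forall>i. 0 \<le> p $ i) \<and> (\<Sum>i\<in>UNIV. p $ i) = 1}"

definition sel_set :: "real \<Rightarrow> (real^'d) set" where
  "sel_set \<epsilon> = {p. \<forall>i. p $ i \<in> {\<epsilon>..1}} \<inter> sel_simplex"

definition tv_dist :: "'b measure \<Rightarrow> 'b measure \<Rightarrow> real" where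
  "tv_dist \<mu> \<nu> = (SUP A\<in>sets \<mu>. \<bar>measure \<mu> A - measure \<nu> A\<bar>)"

primrec kernel_pow :: "'b measure \<Rightarrow> ('b \<Rightarrow> 'b measure) \<Rightarrow> nat \<Rightarrow> 'b \<Rightarrow> 'b measure" where
  "kernel_pow S P 0 x = return S x"
| "kernel_pow S P (Suc n) x = kernel_pow S P n x \<bind> P"

definition uniformly_ergodic :: "'b measure \<Rightarrow> ('b \<Rightarrow> 'b measure) \<Rightarrow> bool" where
  "uniformly_ergodic \<mu> P \<longleftrightarrow> \<mu> \<bind> P = \<mu> \<and>
     (\<exists>C \<rho>. \<rho> < 1 \<and> (\<forall>x\<in>space \<mu>. \<forall>n. tv_dist (kernel_pow \<mu> P n x) \<mu> \<le> C * \<rho> ^ n))"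

text \<open>
  \<open>K i\<close> is a version of the regular conditional distribution of \<open>Z_i\<close> given \<open>Z_{-i}\<close> for
  \<open>Z \<sim> \<mu>\<close>. Versions are unique only up to null sets, while the Gibbs kernels are applied at every
  point, so a version is fixed once and for all and passed to all samplers.
\<close>

definition full_conditionals ::
  "('d \<Rightarrow> 'a measure) \<Rightarrow> ('d \<Rightarrow> 'a) measure \<Rightarrow> ('d \<Rightarrow> ('d \<Rightarrow> 'a) \<Rightarrow> 'a measure) \<Rightarrow> bool" where
  "full_conditionals M \<mu> K \<longleftrightarrow>
     (\<forall>i. K i \<in> PiM (- {i}) M \<rightarrow>\<^sub>M prob_algebra (M i) \<and>
       (\<forall>A\<in>sets (PiM (- {i}) M). \<forall>B\<in>sets (M i).
          emeasure \<mu> {x \<in> space \<mu>. restrict x (- {i}) \<in> A \<and> x i \<in> B} =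
          (\<integral>\<^sup>+y\<in>A. emeasure (K i y) B \<partial>distr \<mu> (PiM (- {i}) M) (\<lambda>x. restrict x (- {i})))))"

text \<open>The kernel of RSG: choose \<open>i\<close> with probability \<open>a $ i\<close>, then redraw coordinate \<open>i\<close>.\<close>

definition rsg ::
  "('d::finite \<Rightarrow> 'a measure) \<Rightarrow> ('d \<Rightarrow> ('d \<Rightarrow> 'a) \<Rightarrow> 'a measure) \<Rightarrow> real^'d \<Rightarrow>
     ('d \<Rightarrow> 'a) \<Rightarrow> ('d \<Rightarrow> 'a) measure" where
  "rsg M K a x =
     point_measure UNIV (\<lambda>i. ennreal (a $ i)) \<bind>
       (\<lambda>i. distr (K i (restrict x (- {i}))) (PiM UNIV M) (\<lambda>y. x(i := y)))"

text \<open>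
  \<open>R n\<close> maps \<open>\<alpha>_{n-1}\<close> and the past \<open>(X_0, ..., X_{n-1})\<close>, represented as a function on
  \<open>{0..<n}\<close>, to \<open>\<alpha>_n\<close>. The value \<open>R 0\<close> is never used.
\<close>

definition update_rule ::
  "'s measure \<Rightarrow> (real^'d) set \<Rightarrow> (nat \<Rightarrow> real^'d \<Rightarrow> (nat \<Rightarrow> 's) \<Rightarrow> real^'d) \<Rightarrow> bool" where
  "update_rule S Y R \<longleftrightarrow>
     (\<forall>n\<ge>1. (\<lambda>(a, h). R n a h) \<in>
        restrict_space borel Y \<Otimes>\<^sub>M PiM {0..<n} (\<lambda>_. S) \<rightarrow>\<^sub>M restrict_space borel Y)"

primrec adap_sel ::
  "(nat \<Rightarrow> real^'d \<Rightarrow> (nat \<Rightarrow> 's) \<Rightarrow> real^'d) \<Rightarrow> real^'d \<Rightarrow> nat \<Rightarrow> (nat \<Rightarrow> 's) \<Rightarrow> real^'d" where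
  "adap_sel R a0 0 \<omega> = a0"
| "adap_sel R a0 (Suc n) \<omega> = R (Suc n) (adap_sel R a0 n \<omega>) (restrict \<omega> {0..<Suc n})"

text \<open>The law of \<open>X_n\<close> given \<open>X_0, ..., X_{n-1}\<close>.\<close>

primrec adap_step ::
  "('d::finite \<Rightarrow> 'a measure) \<Rightarrow> ('d \<Rightarrow> ('d \<Rightarrow> 'a) \<Rightarrow> 'a measure) \<Rightarrow>
     (nat \<Rightarrow> real^'d \<Rightarrow> (nat \<Rightarrow> 'd \<Rightarrow> 'a) \<Rightarrow> real^'d) \<Rightarrow> ('d \<Rightarrow> 'a) \<Rightarrow> real^'d \<Rightarrow>
     nat \<Rightarrow> (nat \<Rightarrow> 'd \<Rightarrow> 'a) \<Rightarrow> ('d \<Rightarrow> 'a) measure" where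
  "adap_step M K R x0 a0 0 \<omega> = return (PiM UNIV M) x0"
| "adap_step M K R x0 a0 (Suc n) \<omega> = rsg M K (adap_sel R a0 (Suc n) \<omega>) (\<omega> n)"

text \<open>
  The law of the whole trajectory \<open>(X_0, X_1, ...)\<close> of AdapRSG started from \<open>x0\<close> and \<open>a0\<close>, that is
  the measure on the sequence space which the Ionescu-Tulcea theorem yields for \<open>adap_step\<close>.
\<close>

definition adap_traj ::
  "('d::finite \<Rightarrow> 'a measure) \<Rightarrow> ('d \<Rightarrow> ('d \<Rightarrow> 'a) \<Rightarrow> 'a measure) \<Rightarrow>
     (nat \<Rightarrow> real^'d \<Rightarrow> (nat \<Rightarrow> 'd \<Rightarrow> 'a) \<Rightarrow> real^'d) \<Rightarrow> ('d \<Rightarrow> 'a) \<Rightarrow> real^'d \<Rightarrow>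
     (nat \<Rightarrow> 'd \<Rightarrow> 'a) measure" where
  "adap_traj M K R x0 a0 =
     projective_family.lim UNIV
       (Ionescu_Tulcea.CI (adap_step M K R x0 a0) (\<lambda>_. PiM UNIV M)) (\<lambda>_. PiM UNIV M)"

definition adap_law ::
  "('d::finite \<Rightarrow> 'a measure) \<Rightarrow> ('d \<Rightarrow> ('d \<Rightarrow> 'a) \<Rightarrow> 'a measure) \<Rightarrow>
     (nat \<Rightarrow> real^'d \<Rightarrow> (nat \<Rightarrow> 'd \<Rightarrow> 'a) \<Rightarrow> real^'d) \<Rightarrow> ('d \<Rightarrow> 'a) \<Rightarrow> real^'d \<Rightarrow>
     nat \<Rightarrow> ('d \<Rightarrow> 'a) measure" where
  "adap_law M K R x0 a0 n = distr (adap_traj M K R x0 a0) (PiM UNIV M) (\<lambda>\<omega>. \<omega> n)"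

text \<open>
  The probability that \<open>|\<alpha>_{n+1} - \<alpha>_n| > \<delta>\<close> for the starting values \<open>x0\<close> and \<open>a0\<close>. The chains
  for different starting values live on different probability spaces; convergence in probability
  uniformly over the starting values means that the supremum of these probabilities tends to 0
  for every \<open>\<delta> > 0\<close>. For chains defined jointly on one probability space this is implied by
  convergence in (outer) probability of the pathwise supremum.
\<close>

definition adap_change_prob ::
  "('d::finite \<Rightarrow> 'a measure) \<Rightarrow> ('d \<Rightarrow> ('d \<Rightarrow> 'a) \<Rightarrow> 'a measure) \<Rightarrow>
     (nat \<Rightarrow> real^'d \<Rightarrow> (nat \<Rightarrow> 'd \<Rightarrow> 'a) \<Rightarrow> real^'d) \<Rightarrow> ('d \<Rightarrow> 'a) \<Rightarrow> real^'d \<Rightarrow>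
     real \<Rightarrow> nat \<Rightarrow> real" where
  "adap_change_prob M K R x0 a0 \<delta> n =
     measure (adap_traj M K R x0 a0)
       {\<omega> \<in> space (adap_traj M K R x0 a0).
          norm (adap_sel R a0 (Suc n) \<omega> - adap_sel R a0 n \<omega>) > \<delta>}"

end

theory Submission
  imports Defs
begin

text \<open>
  Since selection probabilities in \<open>Y\<close> are at least \<open>\<epsilon>\<close> and at most 1, the kernels satisfy
  \<open>P_a \<ge> \<epsilon> P_\<beta>\<close>, hence \<open>P_a^m \<ge> \<epsilon>^m P_\<beta>^m\<close>. Choosing \<open>m\<close> such that \<open>P_\<beta>^m(x, \<cdot>)\<close> is within
  \<open>1/4\<close> of \<open>\<pi>\<close> for all \<open>x\<close>, the kernel \<open>P_a^m\<close> contracts the uniform distance of a function to its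
  \<open>\<pi>\<close>-mean by the factor \<open>1 - \<epsilon>^m/2\<close>, for all \<open>a \<in> Y\<close> simultaneously. For an adaptive chain, let
  \<open>f\<close> be an indicator and telescope \<open>E f(X_{n+N}) - E (P_{\<alpha>_n}^N f)(X_n)\<close> along
  \<open>E (P_{\<alpha>_n}^{N-k} f)(X_{n+k})\<close>: the \<open>k\<close>-th increment is at most the mean of
  \<open>|\<alpha>_{n+k+1} - \<alpha>_n|\<close>, which vanishes as \<open>n \<rightarrow> \<infinity>\<close> for fixed \<open>N\<close> by diminishing adaptation.
\<close>

section \<open>Integrals, kernels and total variation\<close>

lemma integral_prob_bounds:
  fixes f :: "'b \<Rightarrow> real"
  assumes "prob_space \<mu>" "f \<in> borel_measurable \<mu>"
    and "\<And>x. x \<in> space \<mu> \<Longrightarrow> l \<le> f x" "\<And>x. x \<in> space \<mu> \<Longrightarrow> f x \<le> u"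
  shows "integrable \<mu> f" "l \<le> (\<integral>x. f x \<partial>\<mu>)" "(\<integral>x. f x \<partial>\<mu>) \<le> u"
proof -
  interpret prob_space \<mu> by fact
  show int: "integrable \<mu> f"
    using assms(2-4) by (intro integrable_const_bound[where B="max \<bar>l\<bar> \<bar>u\<bar>"] AE_I2) fastforce+
  show "l \<le> (\<integral>x. f x \<partial>\<mu>)"
    using assms(3) by (intro integral_ge_const int AE_I2) auto
  show "(\<integral>x. f x \<partial>\<mu>) \<le> u"
    using assms(4) by (intro integral_le_const int AE_I2) auto
qed

lemma integral_bind_prob_algebra:
  fixes f :: "'c \<Rightarrow> real"
  assumes \<mu>: "\<mu> \<in> space (prob_algebra S)" and P: "P \<in> S \<rightarrow>\<^sub>M prob_algebra T"
    and f: "f \<in> borel_measurable T" "\<And>x. x \<in> space T \<Longrightarrow> \<bar>f x\<bar> \<le> B"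
  shows "(\<integral>x. f x \<partial>(\<mu> \<bind> P)) = (\<integral>x. \<integral>y. f y \<partial>P x \<partial>\<mu>)"
proof -
  from \<mu> have sets: "sets \<mu> = sets S" and prob: "prob_space \<mu>"
    by (auto simp: space_prob_algebra)
  have P': "P \<in> \<mu> \<rightarrow>\<^sub>M prob_algebra T"
    using P sets by (simp cong: measurable_cong_sets)
  show ?thesis
  proof (rule integral_bind[OF f measurable_prob_algebraD[OF P']])
    show "finite_measure \<mu>"
      using prob by (rule prob_space.finite_measure)
    show "AE x in \<mu>. emeasure (P x) (space (P x)) \<le> ennreal 1"
      using measurable_space[OF P']
      by (intro AE_I2) (auto simp: space_prob_algebra prob_space.emeasure_space_1)
  qed
qed

text \<open>Pushing \<open>L x\<close> forward along \<open>\<lambda>y. (x, y)\<close> gives a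
  kernel into the product space, and the integral of the section becomes the integral of one fixed
  function against that kernel.\<close>

lemma measurable_integral_prob_algebra2:
  fixes f :: "'a \<Rightarrow> 'b \<Rightarrow> real"
  assumes f[measurable]: "(\<lambda>(x, y). f x y) \<in> borel_measurable (M \<Otimes>\<^sub>M N)"
    and L[measurable]: "L \<in> M \<rightarrow>\<^sub>M prob_algebra N"
  shows "(\<lambda>x. \<integral>y. f x y \<partial>L x) \<in> borel_measurable M"
proof -
  have L'[measurable]: "L \<in> M \<rightarrow>\<^sub>M subprob_algebra N"
    using L by (rule measurable_prob_algebraD)
  have "(\<lambda>x. distr (L x) (M \<Otimes>\<^sub>M N) (\<lambda>y. (x, y))) \<in> M \<rightarrow>\<^sub>M subprob_algebra (M \<Otimes>\<^sub>M N)"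
    by (rule measurable_distr2[OF _ L']) measurable
  from measurable_compose[OF this integral_measurable_subprob_algebra[OF f]]
  show ?thesis
    by (rule measurable_cong[THEN iffD1, rotated])
       (simp add: integral_distr sets_kernel[OF L'] cong: measurable_cong_sets)
qed

section \<open>Iterates of a Markov kernel\<close>

lemma measurable_kernel_pow:
  assumes "P \<in> S \<rightarrow>\<^sub>M prob_algebra S"
  shows "kernel_pow S P n \<in> S \<rightarrow>\<^sub>M prob_algebra S"
proof (induction n)
  case 0
  show ?case by (simp add: measurable_return_prob_space cong: measurable_cong)
next
  case (Suc n)
  show ?case
    using measurable_bind_prob_space[OF Suc assms] by (simp cong: measurable_cong)
qed

lemma measurable_kernel_pow_param:
  assumes [measurable]: "(\<lambda>(a, x). P a x) \<in> Y \<Otimes>\<^sub>M S \<rightarrow>\<^sub>M prob_algebra S"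
  shows "(\<lambda>(a, x). kernel_pow S (P a) n x) \<in> Y \<Otimes>\<^sub>M S \<rightarrow>\<^sub>M prob_algebra S"
proof (induction n)
  case (Suc n)
  note Suc[measurable]
  show ?case
    unfolding kernel_pow.simps by measurable
qed simp

text \<open>Chapman-Kolmogorov: \<open>kernel_pow\<close> appends steps at the end, and
  associativity of bind allows a cut anywhere, in particular after the first step or the first block
  of steps.\<close>

lemma kernel_pow_add:
  assumes P: "P \<in> S \<rightarrow>\<^sub>M prob_algebra S" and x: "x \<in> space S"
  shows "kernel_pow S P (m + n) x = kernel_pow S P m x \<bind> kernel_pow S P n"
proof (induction n)
  have pow: "kernel_pow S P m x \<in> space (prob_algebra S)" for m
    using measurable_kernel_pow[OF P] x by (rule measurable_space)
  then have sets: "sets (kernel_pow S P m x) = sets S" for m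
    by (simp add: space_prob_algebra)
  {
    case 0
    have "kernel_pow S P 0 = return S" by (simp add: fun_eq_iff)
    then show ?case by (simp add: bind_return''[OF sets])
  next
    case (Suc n)
    have "kernel_pow S P n \<in> kernel_pow S P m x \<rightarrow>\<^sub>M subprob_algebra S"
      using measurable_prob_algebraD[OF measurable_kernel_pow[OF P]]
      by (simp add: measurable_cong_sets[OF sets refl])
    from bind_assoc[OF this measurable_prob_algebraD[OF P]] Suc
    show ?case by simp
  }
qed

lemma integral_kernel_pow_add:
  fixes f :: "'b \<Rightarrow> real"
  assumes P: "P \<in> S \<rightarrow>\<^sub>M prob_algebra S" and x: "x \<in> space S"
    and f: "f \<in> borel_measurable S" "\<And>x. x \<in> space S \<Longrightarrow> \<bar>f x\<bar> \<le> B"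
  shows "(\<integral>y. f y \<partial>kernel_pow S P (m + n) x) =
    (\<integral>y. \<integral>z. f z \<partial>kernel_pow S P n y \<partial>kernel_pow S P m x)"
  unfolding kernel_pow_add[OF P x]
  by (rule integral_bind_prob_algebra[OF measurable_space[OF measurable_kernel_pow[OF P] x]
        measurable_kernel_pow[OF P] f])

section \<open>Total variation distance and integrals of bounded functions\<close>

lemma tv_dist_upper:
  assumes "prob_space \<mu>" "prob_space \<nu>" "A \<in> sets \<mu>"
  shows "\<bar>measure \<mu> A - measure \<nu> A\<bar> \<le> tv_dist \<mu> \<nu>"
  unfolding tv_dist_def
proof (rule cSUP_upper[OF assms(3)])
  show "bdd_above ((\<lambda>A. \<bar>measure \<mu> A - measure \<nu> A\<bar>) ` sets \<mu>)"
  proof (rule bdd_aboveI2)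
    fix A
    show "\<bar>measure \<mu> A - measure \<nu> A\<bar> \<le> 1"
      using prob_space.prob_le_1[OF assms(1), of A] prob_space.prob_le_1[OF assms(2), of A]
        measure_nonneg[of \<mu> A] measure_nonneg[of \<nu> A] by linarith
  qed
qed

lemma tv_dist_least:
  assumes "\<And>A. A \<in> sets \<mu> \<Longrightarrow> \<bar>measure \<mu> A - measure \<nu> A\<bar> \<le> t"
  shows "tv_dist \<mu> \<nu> \<le> t"
  unfolding tv_dist_def using assms by (intro cSUP_least) auto

text \<open>Up to an error \<open>1 / n\<close>, \<open>f\<close> is the average of the indicators
  of \<open>n\<close> superlevel sets, and each of these sets contributes at most
  \<open>tv_dist \<mu> \<nu>\<close>. Averaging keeps the constant 1.\<close>

lemma integral_diff_le_tv_dist: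
  fixes f :: "'b \<Rightarrow> real"
  assumes \<mu>: "prob_space \<mu>" and \<nu>: "prob_space \<nu>" and sets: "sets \<nu> = sets \<mu>"
    and f[measurable]: "f \<in> borel_measurable \<mu>" and f01: "\<And>x. x \<in> space \<mu> \<Longrightarrow> f x \<in> {0..1}"
  shows "\<bar>(\<integral>x. f x \<partial>\<mu>) - (\<integral>x. f x \<partial>\<nu>)\<bar> \<le> tv_dist \<mu> \<nu>"
proof (rule field_le_epsilon)
  fix e :: real assume "0 < e"
  \<comment> \<open>Each of the two integrals is approximated up to \<open>1 / n\<close>, so
    \<open>2 / n\<close> must stay below \<open>e\<close>.\<close>
  obtain n :: nat where n: "2 / e < real n"
    using reals_Archimedean2 by blast
  with \<open>0 < e\<close> have n0: "0 < real n"
    by (meson divide_pos_pos less_trans zero_less_numeral)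
  \<comment> \<open>the step function \<open>floor (n f) / n\<close>, written as an average of indicators\<close>
  define A where "A k = {x \<in> space \<mu>. real k \<le> n * f x}" for k :: nat
  define g where "g x = (\<Sum>k\<in>{1..n}. indicator (A k) x) / n" for x
  have A: "A k \<in> sets \<mu>" for k
    unfolding A_def by measurable
  have g: "\<bar>f x - g x\<bar> \<le> 1 / n" if "x \<in> space \<mu>" for x
  proof -
    have fx: "0 \<le> n * f x" "n * f x \<le> n"
      using f01[OF that] n0 by (auto simp: mult_left_le)
    have "(\<Sum>k\<in>{1..n}. indicator (A k) x :: real) = card {k \<in> {1..n}. x \<in> A k}"
      by (simp add: indicator_def sum.If_cases Int_def)
    \<comment> \<open>The sets \<open>A k\<close> decrease in \<open>k\<close>, so counting those
      that contain \<open>x\<close> yields the integer part.\<close>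
    also have "{k \<in> {1..n}. x \<in> A k} = {1..nat \<lfloor>n * f x\<rfloor>}"
      using fx that by (auto simp: A_def le_nat_iff le_floor_iff)
    finally have "g x = \<lfloor>n * f x\<rfloor> / n"
      using fx by (simp add: g_def)
    then have "f x - g x = (n * f x - \<lfloor>n * f x\<rfloor>) / n"
      using n0 by (simp add: field_simps)
    moreover have "\<bar>n * f x - \<lfloor>n * f x\<rfloor>\<bar> \<le> 1" by linarith
    ultimately show ?thesis
      using n0 by (simp add: divide_right_mono)
  qed
  have approx: "\<bar>(\<integral>x. f x \<partial>\<rho>) - (\<Sum>k\<in>{1..n}. measure \<rho> (A k)) / n\<bar> \<le> 1 / n"
    if \<rho>: "prob_space \<rho>" and s: "sets \<rho> = sets \<mu>" for \<rho>
  proof -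
    interpret prob_space \<rho> by fact
    have sp: "space \<rho> = space \<mu>" using s by (rule sets_eq_imp_space_eq)
    have f\<rho>[measurable]: "f \<in> borel_measurable \<rho>" using f s by (simp cong: measurable_cong_sets)
    have A\<rho>[measurable]: "A k \<in> sets \<rho>" for k using A s by simp
    have if': "integrable \<rho> f"
      by (rule integral_prob_bounds[OF \<rho> f\<rho>, of 0 1]) (use f01 sp in auto)
    have ig: "integrable \<rho> g"
      unfolding g_def by (intro integrable_divide Bochner_Integration.integrable_sum)
        (simp add: emeasure_eq_measure)
    have "(\<integral>x. g x \<partial>\<rho>) = (\<Sum>k\<in>{1..n}. measure \<rho> (A k)) / n"
      unfolding g_def by (subst integral_divide_zero, subst Bochner_Integration.integral_sum)
        (auto simp: emeasure_eq_measure)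
    moreover have "\<bar>(\<integral>x. f x - g x \<partial>\<rho>)\<bar> \<le> 1 / n"
      using integral_prob_bounds(2,3)[OF \<rho>, of "\<lambda>x. f x - g x" "- (1 / n)" "1 / n"] g sp ig
      by (fastforce simp: abs_le_iff g_def)
    ultimately show ?thesis
      by (simp add: Bochner_Integration.integral_diff[OF if' ig])
  qed
  have "\<bar>(\<Sum>k\<in>{1..n}. measure \<mu> (A k)) - (\<Sum>k\<in>{1..n}. measure \<nu> (A k))\<bar> \<le>
      (\<Sum>k\<in>{1..n}. tv_dist \<mu> \<nu>)"
    unfolding sum_subtractf[symmetric]
    by (rule order_trans[OF sum_abs sum_mono]) (rule tv_dist_upper[OF \<mu> \<nu> A])
  then have "\<bar>(\<Sum>k\<in>{1..n}. measure \<mu> (A k)) / n - (\<Sum>k\<in>{1..n}. measure \<nu> (A k)) / n\<bar> \<le>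
      tv_dist \<mu> \<nu>"
    using n0 by (simp add: diff_divide_distrib[symmetric] field_simps)
  moreover have "1 / n + 1 / n < e"
    using n n0 \<open>0 < e\<close> by (simp add: field_simps)
  ultimately show "\<bar>(\<integral>x. f x \<partial>\<mu>) - (\<integral>x. f x \<partial>\<nu>)\<bar> \<le> tv_dist \<mu> \<nu> + e"
    using approx[OF \<mu> refl] approx[OF \<nu> sets] by linarith
qed

section \<open>Geometric convergence from a minorization\<close>

lemma kernel_pow_stationary:
  assumes P: "P \<in> S \<rightarrow>\<^sub>M prob_algebra S" and \<mu>: "\<mu> \<in> space (prob_algebra S)"
    and stat: "\<mu> \<bind> P = \<mu>"
  shows "\<mu> \<bind> kernel_pow S P n = \<mu>"
proof (induction n)
  have sets: "sets \<mu> = sets S" using \<mu> by (simp add: space_prob_algebra)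
  {
    case 0
    have "kernel_pow S P 0 = return S" by (simp add: fun_eq_iff)
    then show ?case by (simp add: bind_return''[OF sets])
  next
    case (Suc n)
    have "kernel_pow S P n \<in> \<mu> \<rightarrow>\<^sub>M subprob_algebra S"
      using measurable_prob_algebraD[OF measurable_kernel_pow[OF P]]
      by (simp add: measurable_cong_sets[OF sets refl])
    from bind_assoc[OF this measurable_prob_algebraD[OF P]] Suc stat
    show ?case by simp
  }
qed

lemma measurable_integral_kernel:
  fixes f :: "'b \<Rightarrow> real"
  assumes "P \<in> S \<rightarrow>\<^sub>M prob_algebra T" "f \<in> borel_measurable T"
  shows "(\<lambda>x. \<integral>y. f y \<partial>P x) \<in> borel_measurable S"
  using assms by (intro measurable_integral_prob_algebra2) simp_all

lemma integral_kernel_bounds: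
  fixes f :: "'b \<Rightarrow> real"
  assumes P: "P \<in> S \<rightarrow>\<^sub>M prob_algebra T" and x: "x \<in> space S"
    and f: "f \<in> borel_measurable T" "\<And>y. y \<in> space T \<Longrightarrow> f y \<in> {l..u}"
  shows "integrable (P x) f" "(\<integral>y. f y \<partial>P x) \<in> {l..u}"
proof -
  have Px: "prob_space (P x)" "sets (P x) = sets T"
    using measurable_space[OF P x] by (simp_all add: space_prob_algebra)
  then have "space (P x) = space T" "f \<in> borel_measurable (P x)"
    using f(1) sets_eq_imp_space_eq[OF Px(2)] by (simp_all cong: measurable_cong_sets)
  with integral_prob_bounds[OF Px(1), of f l u] f(2)
  show "integrable (P x) f" "(\<integral>y. f y \<partial>P x) \<in> {l..u}" by simp_all
qed

text \<open>Domination is expressed through integrals of functions with values in [0,1], a class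
  that both kernels preserve. So the last step can be exchanged first and the remaining
  \<open>m\<close> steps by induction.\<close>

lemma kernel_pow_minorization:
  fixes f :: "'b \<Rightarrow> real"
  assumes P: "P \<in> S \<rightarrow>\<^sub>M prob_algebra S" and Q: "Q \<in> S \<rightarrow>\<^sub>M prob_algebra S" and "0 \<le> e"
    and PQ: "\<And>h x. h \<in> borel_measurable S \<Longrightarrow> (\<And>y. y \<in> space S \<Longrightarrow> h y \<in> {0..1::real}) \<Longrightarrow>
      x \<in> space S \<Longrightarrow> e * (\<integral>y. h y \<partial>Q x) \<le> (\<integral>y. h y \<partial>P x)"
    and f: "f \<in> borel_measurable S" "\<And>y. y \<in> space S \<Longrightarrow> f y \<in> {0..1}" and x: "x \<in> space S"
  shows "e ^ m * (\<integral>y. f y \<partial>kernel_pow S Q m x) \<le> (\<integral>y. f y \<partial>kernel_pow S P m x)"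
  using f
proof (induction m arbitrary: f)
  case (Suc m)
  note Pm = measurable_kernel_pow[OF P] and Qm = measurable_kernel_pow[OF Q]
  let ?Pf = "\<lambda>y. \<integral>z. f z \<partial>P y" and ?Qf = "\<lambda>y. \<integral>z. f z \<partial>Q y"
  have Pf: "?Pf \<in> borel_measurable S" "y \<in> space S \<Longrightarrow> ?Pf y \<in> {0..1}" for y
    using measurable_integral_kernel[OF P Suc.prems(1)] integral_kernel_bounds(2)[OF P _ Suc.prems] by auto
  have Qf: "?Qf \<in> borel_measurable S" "y \<in> space S \<Longrightarrow> ?Qf y \<in> {0..1}" for y
    using measurable_integral_kernel[OF Q Suc.prems(1)] integral_kernel_bounds(2)[OF Q _ Suc.prems] by auto
  have b: "\<bar>f y\<bar> \<le> 1" if "y \<in> space S" for y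
    using Suc.prems(2)[OF that] by auto
  have sp: "space (kernel_pow S Q m x) = space S"
    using measurable_space[OF Qm x] by (auto simp: space_prob_algebra dest: sets_eq_imp_space_eq)
  have "e ^ Suc m * (\<integral>y. f y \<partial>kernel_pow S Q (Suc m) x) =
      e ^ m * (\<integral>y. e * ?Qf y \<partial>kernel_pow S Q m x)"
    using integral_bind_prob_algebra[OF measurable_space[OF Qm x] Q Suc.prems(1) b] by simp
  also have "\<dots> \<le> e ^ m * (\<integral>y. ?Pf y \<partial>kernel_pow S Q m x)"
    using \<open>0 \<le> e\<close> PQ[OF Suc.prems]
      integral_kernel_bounds(1)[OF Qm x Qf] integral_kernel_bounds(1)[OF Qm x Pf]
    by (intro mult_left_mono integral_mono) (auto simp: sp)
  \<comment> \<open>The induction hypothesis is used for \<open>?Pf\<close> in place of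
    \<open>f\<close>, which is why \<open>f\<close> is kept arbitrary.\<close>
  also have "\<dots> \<le> (\<integral>y. ?Pf y \<partial>kernel_pow S P m x)"
    by (rule Suc.IH) (use Pf in auto)
  also have "\<dots> = (\<integral>y. f y \<partial>kernel_pow S P (Suc m) x)"
    using integral_bind_prob_algebra[OF measurable_space[OF Pm x] P Suc.prems(1) b] by simp
  finally show ?case .
qed simp

text \<open>A function within \<open>r\<close> of its mean is rescaled to values in [0,1] with mean
  1/2. Under \<open>L'\<close> its integral is still at least 1/4, hence at least
  \<open>c / 4\<close> under \<open>L\<close>; undoing the scaling by \<open>2 * r\<close> improves
  the lower bound \<open>- r\<close> by \<open>c * r / 2\<close>.\<close>

lemma kernel_contraction:
  fixes f :: "'b \<Rightarrow> real"
  assumes L: "L \<in> S \<rightarrow>\<^sub>M prob_algebra S" and L': "L' \<in> S \<rightarrow>\<^sub>M prob_algebra S"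
    and \<mu>: "\<mu> \<in> space (prob_algebra S)" and "0 \<le> c"
    and minor: "\<And>h x. h \<in> borel_measurable S \<Longrightarrow> (\<And>y. y \<in> space S \<Longrightarrow> h y \<in> {0..1::real}) \<Longrightarrow>
      x \<in> space S \<Longrightarrow> c * (\<integral>y. h y \<partial>L' x) \<le> (\<integral>y. h y \<partial>L x)"
    and close: "\<And>h x. h \<in> borel_measurable S \<Longrightarrow> (\<And>y. y \<in> space S \<Longrightarrow> h y \<in> {0..1::real}) \<Longrightarrow>
      x \<in> space S \<Longrightarrow> (\<integral>y. h y \<partial>\<mu>) - 1 / 4 \<le> (\<integral>y. h y \<partial>L' x)"
    and f: "f \<in> borel_measurable S" "0 < r" "\<And>y. y \<in> space S \<Longrightarrow> \<bar>f y - (\<integral>z. f z \<partial>\<mu>)\<bar> \<le> r"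
    and x: "x \<in> space S"
  shows "\<bar>(\<integral>y. f y \<partial>L x) - (\<integral>z. f z \<partial>\<mu>)\<bar> \<le> (1 - c / 2) * r"
proof -
  have lower: "- ((1 - c / 2) * r) \<le> (\<integral>y. h y \<partial>L x) - (\<integral>z. h z \<partial>\<mu>)"
    if h: "h \<in> borel_measurable S" "\<And>y. y \<in> space S \<Longrightarrow> \<bar>h y - (\<integral>z. h z \<partial>\<mu>)\<bar> \<le> r" for h
  proof -
    define m where "m = (\<integral>z. h z \<partial>\<mu>)"
    define g where "g y = (h y - m + r) / (2 * r)" for y
    have g: "g \<in> borel_measurable S" "\<And>y. y \<in> space S \<Longrightarrow> g y \<in> {0..1}"
      unfolding g_def using h \<open>0 < r\<close> by (auto simp: m_def field_simps abs_le_iff)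
    have g_int: "(\<integral>y. g y \<partial>\<rho>) = ((\<integral>y. h y \<partial>\<rho>) - m + r) / (2 * r)"
      if \<rho>: "\<rho> \<in> space (prob_algebra S)" for \<rho>
    proof -
      interpret prob_space \<rho> using \<rho> by (simp add: space_prob_algebra)
      have "h y \<in> {m - r..m + r}" if "y \<in> space S" for y
        using h(2)[OF that] by (auto simp: m_def abs_le_iff)
      \<comment> \<open>\<open>\<rho>\<close> is viewed as a constant kernel on a discrete source
        space, where any point may serve as argument.\<close>
      then have "integrable \<rho> h"
        using \<rho> h(1) integral_kernel_bounds(1)[of "\<lambda>_. \<rho>" "count_space UNIV" S undefined h]
        by (auto intro!: measurable_const)
      then show ?thesis
        by (simp add: g_def prob_space)
    qed
    have Lx: "L x \<in> space (prob_algebra S)" "L' x \<in> space (prob_algebra S)"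
      using measurable_space[OF L x] measurable_space[OF L' x] .
    have half: "(\<integral>y. g y \<partial>\<mu>) = 1 / 2"
      using g_int[OF \<mu>] \<open>0 < r\<close> by (simp add: m_def)
    have "c * (1 / 4) \<le> c * ((\<integral>y. g y \<partial>\<mu>) - 1 / 4)"
      unfolding half by simp
    also have "\<dots> \<le> c * (\<integral>y. g y \<partial>L' x)"
      using g \<open>0 \<le> c\<close> x by (intro mult_left_mono close) auto
    also have "\<dots> \<le> (\<integral>y. g y \<partial>L x)"
      using g x by (intro minor) auto
    finally show ?thesis
      using \<open>0 < r\<close> unfolding g_int[OF Lx(1)] m_def[symmetric] by (simp add: field_simps)
  qed
  \<comment> \<open>The upper bound for \<open>f\<close> is the lower bound for
    \<open>- f\<close>.\<close>
  have "- ((1 - c / 2) * r) \<le> (\<integral>y. - f y \<partial>L x) - (\<integral>z. - f z \<partial>\<mu>)"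
    using f by (intro lower) (auto simp: abs_minus_commute)
  then show ?thesis
    using lower[OF f(1,3)] by (simp add: abs_le_iff)
qed

text \<open>Time is cut into \<open>q\<close> blocks of \<open>m\<close> steps, each of which
  contracts the distance to the mean. The rate depends on \<open>P\<close> only through
  \<open>e\<close>, so one bound serves all kernels that dominate \<open>e\<close> times
  \<open>Q\<close>.\<close>

lemma kernel_pow_geometric_convergence:
  fixes f :: "'b \<Rightarrow> real"
  assumes P: "P \<in> S \<rightarrow>\<^sub>M prob_algebra S" and Q: "Q \<in> S \<rightarrow>\<^sub>M prob_algebra S"
    and e: "0 < e" "e \<le> 1"
    and PQ: "\<And>h x. h \<in> borel_measurable S \<Longrightarrow> (\<And>y. y \<in> space S \<Longrightarrow> h y \<in> {0..1::real}) \<Longrightarrow>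
      x \<in> space S \<Longrightarrow> e * (\<integral>y. h y \<partial>Q x) \<le> (\<integral>y. h y \<partial>P x)"
    and \<mu>: "\<mu> \<in> space (prob_algebra S)" and stat: "\<mu> \<bind> P = \<mu>"
    and tv: "\<And>x. x \<in> space S \<Longrightarrow> tv_dist (kernel_pow S Q m x) \<mu> \<le> 1 / 4"
    and f: "f \<in> borel_measurable S" "\<And>y. y \<in> space S \<Longrightarrow> f y \<in> {0..1}" and x: "x \<in> space S"
  shows "\<bar>(\<integral>y. f y \<partial>kernel_pow S P (m * q) x) - (\<integral>y. f y \<partial>\<mu>)\<bar> \<le> (1 - e ^ m / 2) ^ q"
  using x
proof (induction q arbitrary: x)
  note Pm = measurable_kernel_pow[OF P] and Qm = measurable_kernel_pow[OF Q]
  have \<mu>': "prob_space \<mu>" "sets \<mu> = sets S" using \<mu> by (auto simp: space_prob_algebra)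
  have b: "\<bar>f y\<bar> \<le> 1" if "y \<in> space S" for y
    using f(2)[OF that] by auto
  {
    case 0
    have "(\<integral>y. f y \<partial>\<mu>) \<in> {0..1}"
      using integral_kernel_bounds(2)[of "\<lambda>_. \<mu>" "count_space UNIV" S undefined f] f \<mu>
      by (auto intro!: measurable_const)
    with f 0 show ?case by (fastforce simp: integral_return abs_le_iff)
  next
    case (Suc q)
    let ?g = "\<lambda>y. \<integral>z. f z \<partial>kernel_pow S P (m * q) y"
    \<comment> \<open>Stationarity keeps the centre fixed: every iterate of \<open>f\<close> has the
      same mean, so contractions of successive blocks can be multiplied.\<close>
    have g_mean: "(\<integral>y. ?g y \<partial>\<mu>) = (\<integral>y. f y \<partial>\<mu>)"
      using integral_bind_prob_algebra[OF \<mu> Pm f(1) b, of "m * q"]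
      by (simp add: kernel_pow_stationary[OF P \<mu> stat])
    have "(\<integral>y. f y \<partial>kernel_pow S P (m * Suc q) x) = (\<integral>y. ?g y \<partial>kernel_pow S P m x)"
      using integral_kernel_pow_add[OF P Suc.prems f(1) b, of m "m * q"] by simp
    moreover have "\<bar>(\<integral>y. ?g y \<partial>kernel_pow S P m x) - (\<integral>y. ?g y \<partial>\<mu>)\<bar> \<le>
        (1 - e ^ m / 2) * (1 - e ^ m / 2) ^ q"
    proof (rule kernel_contraction[OF Pm Qm[of m] \<mu>])
      show "0 \<le> e ^ m" using e by simp
      then show "e ^ m * (\<integral>y. h y \<partial>kernel_pow S Q m x) \<le> (\<integral>y. h y \<partial>kernel_pow S P m x)"
        if "h \<in> borel_measurable S" "\<And>y. y \<in> space S \<Longrightarrow> h y \<in> {0..1::real}" "x \<in> space S" for h x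
        using kernel_pow_minorization[OF P Q _ PQ that] e by simp
      show "(\<integral>y. h y \<partial>\<mu>) - 1 / 4 \<le> (\<integral>y. h y \<partial>kernel_pow S Q m x)"
        if h: "h \<in> borel_measurable S" "\<And>y. y \<in> space S \<Longrightarrow> h y \<in> {0..1::real}" "x \<in> space S" for h x
      proof -
        have Qx: "prob_space (kernel_pow S Q m x)" "sets (kernel_pow S Q m x) = sets S"
          using measurable_space[OF Qm that(3)] by (auto simp: space_prob_algebra)
        then have "\<bar>(\<integral>y. h y \<partial>kernel_pow S Q m x) - (\<integral>y. h y \<partial>\<mu>)\<bar> \<le> tv_dist (kernel_pow S Q m x) \<mu>"
          using h \<mu>' sets_eq_imp_space_eq[OF Qx(2)]
          by (intro integral_diff_le_tv_dist) (auto simp: measurable_cong_sets[OF Qx(2) refl])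
        with tv[OF that(3)] show ?thesis by linarith
      qed
      show "?g \<in> borel_measurable S"
        using measurable_integral_kernel[OF Pm f(1)] .
      \<comment> \<open>The contraction lemma needs a positive radius; here the factor is at least
        1/2.\<close>
      have "e ^ m \<le> 1" using e by (simp add: power_le_one)
      then show "0 < (1 - e ^ m / 2) ^ q" by simp
      show "\<bar>?g y - (\<integral>y. ?g y \<partial>\<mu>)\<bar> \<le> (1 - e ^ m / 2) ^ q" if "y \<in> space S" for y
        unfolding g_mean using Suc.IH[OF that] .
    qed fact
    ultimately show ?case by (simp add: g_mean)
  }
qed

section \<open>Random scan Gibbs kernels\<close>

text \<open>Isolating the one-coordinate update exhibits \<open>rsg\<close> as a finite mixture
  whose components do not depend on the selection probabilities.\<close>

definition gibbs_step ::
  "('d::finite \<Rightarrow> 'a measure) \<Rightarrow> ('d \<Rightarrow> ('d \<Rightarrow> 'a) \<Rightarrow> 'a measure) \<Rightarrow> 'd \<Rightarrow>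
     ('d \<Rightarrow> 'a) \<Rightarrow> ('d \<Rightarrow> 'a) measure" where
  "gibbs_step M K i x = distr (K i (restrict x (- {i}))) (PiM UNIV M) (\<lambda>y. x(i := y))"

lemma rsg_eq: "rsg M K a x = point_measure UNIV (\<lambda>i. ennreal (a $ i)) \<bind> (\<lambda>i. gibbs_step M K i x)"
  by (simp add: rsg_def gibbs_step_def)

locale gibbs_kernels =
  fixes M :: "'d::finite \<Rightarrow> 'a measure" and K :: "'d \<Rightarrow> ('d \<Rightarrow> 'a) \<Rightarrow> 'a measure"
  assumes measurable_K: "K i \<in> PiM (- {i}) M \<rightarrow>\<^sub>M prob_algebra (M i)"
begin

abbreviation S :: "('d \<Rightarrow> 'a) measure" where "S \<equiv> PiM UNIV M"

lemma measurable_gibbs_step: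
  "gibbs_step M K i \<in> S \<rightarrow>\<^sub>M prob_algebra S"
  unfolding gibbs_step_def
proof (rule measurable_distr_prob_space2)
  show "(\<lambda>x. K i (restrict x (- {i}))) \<in> S \<rightarrow>\<^sub>M prob_algebra (M i)"
    by (rule measurable_compose[OF measurable_restrict_subset measurable_K]) simp
  show "(\<lambda>(x, y). x(i := y)) \<in> S \<Otimes>\<^sub>M M i \<rightarrow>\<^sub>M S"
    unfolding case_prod_beta by (rule measurable_fun_upd[where J=UNIV]) auto
qed

lemma measurable_gibbs_step_index:
  assumes x: "x \<in> space S"
  shows "(\<lambda>i. gibbs_step M K i x) \<in>
    point_measure UNIV (\<lambda>i. ennreal (a $ i)) \<rightarrow>\<^sub>M prob_algebra S"
  using measurable_space[OF measurable_gibbs_step x]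
  by (simp add: measurable_cong_sets[OF sets_point_measure_count_space refl])

lemma prob_space_selection:
  assumes "a \<in> sel_simplex"
  shows "prob_space (point_measure UNIV (\<lambda>i. ennreal (a $ i)))"
  using assms by (intro prob_space_point_measure) (auto simp: sel_simplex_def sum_ennreal)

text \<open>The adaptive chain inserts random selection probabilities, so measurability is needed in
  both arguments jointly. The kernel is a composition: the choice of an index depends measurably on
  \<open>a\<close>, and a finite index type causes no trouble in the update.\<close>

lemma measurable_rsg:
  assumes Y: "Y \<subseteq> sel_simplex"
  shows "(\<lambda>(a, x). rsg M K a x) \<in>
    restrict_space borel Y \<Otimes>\<^sub>M S \<rightarrow>\<^sub>M prob_algebra S"
  unfolding rsg_eq case_prod_beta
proof (rule measurable_bind_prob_space2)
  have "(\<lambda>a. point_measure UNIV (\<lambda>i. ennreal (a $ i))) \<in>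
      restrict_space borel Y \<rightarrow>\<^sub>M prob_algebra (count_space (UNIV :: 'd set))"
  proof (intro measurable_prob_algebraI measurable_subprob_algebra)
    show "prob_space (point_measure UNIV (\<lambda>i. ennreal (a $ i)))"
      if "a \<in> space (restrict_space borel Y)" for a :: "real^'d"
      using that Y by (intro prob_space_selection) (auto simp: space_restrict_space)
    then show "subprob_space (point_measure UNIV (\<lambda>i. ennreal (a $ i)))"
      if "a \<in> space (restrict_space borel Y)" for a :: "real^'d"
      using that by (intro prob_space_imp_subprob_space)
    show "(\<lambda>a. emeasure (point_measure UNIV (\<lambda>i. ennreal (a $ i))) A) \<in>
        borel_measurable (restrict_space borel Y)" for A :: "'d set"
      unfolding emeasure_point_measure_finite[OF finite subset_UNIV]
      by (intro measurable_restrict_space1) measurable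
  qed (simp add: sets_point_measure)
  from measurable_compose[OF measurable_fst this]
  show "(\<lambda>p. point_measure UNIV (\<lambda>i. ennreal (fst p $ i))) \<in>
      restrict_space borel Y \<Otimes>\<^sub>M S \<rightarrow>\<^sub>M prob_algebra (count_space (UNIV :: 'd set))" .
  have "(\<lambda>q. gibbs_step M K (snd q) (snd (fst q))) \<in>
      (restrict_space borel Y \<Otimes>\<^sub>M S) \<Otimes>\<^sub>M count_space UNIV \<rightarrow>\<^sub>M prob_algebra S"
  proof (rule measurable_compose_countable[where f="\<lambda>i q. gibbs_step M K i (snd (fst q))" and g=snd])
    show "(\<lambda>q. gibbs_step M K i (snd (fst q))) \<in>
        (restrict_space borel Y \<Otimes>\<^sub>M S) \<Otimes>\<^sub>M count_space UNIV \<rightarrow>\<^sub>M prob_algebra S"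
      for i
      by (rule measurable_compose[OF _ measurable_gibbs_step]) measurable
  qed measurable
  then show "(\<lambda>(p, i). gibbs_step M K i (snd p)) \<in>
      (restrict_space borel Y \<Otimes>\<^sub>M S) \<Otimes>\<^sub>M count_space UNIV \<rightarrow>\<^sub>M prob_algebra S"
    by (simp add: case_prod_beta)
qed

lemma measurable_rsg_fixed:
  assumes a: "a \<in> sel_simplex"
  shows "rsg M K a \<in> S \<rightarrow>\<^sub>M prob_algebra S"
  using measurable_Pair2[OF measurable_rsg[OF subset_refl], of a] a
  by (simp add: space_restrict_space)

lemma integral_rsg:
  fixes f :: "_ \<Rightarrow> real"
  assumes a: "a \<in> sel_simplex"
    and f: "f \<in> borel_measurable S" "\<And>x. x \<in> space S \<Longrightarrow> \<bar>f x\<bar> \<le> B"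
    and x: "x \<in> space S"
  shows "(\<integral>y. f y \<partial>rsg M K a x) = (\<Sum>i\<in>UNIV. a $ i * (\<integral>y. f y \<partial>gibbs_step M K i x))"
proof -
  have "point_measure UNIV (\<lambda>i. ennreal (a $ i)) \<in>
      space (prob_algebra (point_measure UNIV (\<lambda>i. ennreal (a $ i))))"
    using prob_space_selection[OF a] by (simp add: space_prob_algebra)
  from integral_bind_prob_algebra[OF this measurable_gibbs_step_index[OF x] f]
  show ?thesis
    using a by (simp add: rsg_eq lebesgue_integral_point_measure_finite sel_simplex_def)
qed

lemma emeasure_rsg:
  assumes A: "A \<in> sets S" and x: "x \<in> space S"
  shows "emeasure (rsg M K a x) A = (\<Sum>i\<in>UNIV. ennreal (a $ i) * emeasure (gibbs_step M K i x) A)"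
  unfolding rsg_eq
  by (subst emeasure_bind[OF _ measurable_prob_algebraD[OF measurable_gibbs_step_index[OF x]] A])
     (auto simp: space_point_measure nn_integral_point_measure_finite)

section \<open>Random scan kernels with different selection probabilities\<close>

text \<open>The two mixtures share their components, and the weights satisfy
  \<open>e * b $ i \<le> e \<le> a $ i\<close>. This is where the lower bound on the selection
  probabilities enters.\<close>

lemma integral_rsg_minorization:
  fixes f :: "_ \<Rightarrow> real"
  assumes a: "a \<in> sel_set e" and b: "b \<in> sel_set e" and "0 \<le> e"
    and f: "f \<in> borel_measurable S" "\<And>x. x \<in> space S \<Longrightarrow> f x \<in> {0..1}"
    and x: "x \<in> space S"
  shows "e * (\<integral>y. f y \<partial>rsg M K b x) \<le> (\<integral>y. f y \<partial>rsg M K a x)"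
proof -
  have ab: "a \<in> sel_simplex" "b \<in> sel_simplex"
    using a b by (auto simp: sel_set_def)
  have int: "(\<integral>y. f y \<partial>rsg M K c x) = (\<Sum>i\<in>UNIV. c $ i * (\<integral>y. f y \<partial>gibbs_step M K i x))"
    if "c \<in> sel_simplex" for c
    using f(2) by (intro integral_rsg[OF that f(1) _ x, of 1]) (auto simp: abs_le_iff intro: order_trans[of _ 0])
  have "e * (b $ i * (\<integral>y. f y \<partial>gibbs_step M K i x)) \<le> a $ i * (\<integral>y. f y \<partial>gibbs_step M K i x)" for i
  proof -
    have "e * b $ i \<le> e" "e \<le> a $ i"
      using a b \<open>0 \<le> e\<close> by (auto simp: sel_set_def mult_left_le)
    moreover have "0 \<le> (\<integral>y. f y \<partial>gibbs_step M K i x)"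
      using integral_kernel_bounds(2)[OF measurable_gibbs_step x f] by simp
    ultimately show ?thesis
      by (simp add: mult_right_mono mult.assoc[symmetric])
  qed
  then show ?thesis
    unfolding int[OF ab(1)] int[OF ab(2)] sum_distrib_left
    by (intro sum_mono)
qed

text \<open>Only the weights differ, and each component integrates \<open>f\<close> to a value in
  [0,1].\<close>

lemma integral_rsg_diff_le:
  fixes f :: "_ \<Rightarrow> real"
  assumes a: "a \<in> sel_simplex" and b: "b \<in> sel_simplex"
    and f: "f \<in> borel_measurable S" "\<And>x. x \<in> space S \<Longrightarrow> f x \<in> {0..1}"
    and x: "x \<in> space S"
  shows "\<bar>(\<integral>y. f y \<partial>rsg M K a x) - (\<integral>y. f y \<partial>rsg M K b x)\<bar> \<le> (\<Sum>i\<in>UNIV. \<bar>(a - b) $ i\<bar>)"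
proof -
  have int: "(\<integral>y. f y \<partial>rsg M K c x) = (\<Sum>i\<in>UNIV. c $ i * (\<integral>y. f y \<partial>gibbs_step M K i x))"
    if "c \<in> sel_simplex" for c
    using f(2) by (intro integral_rsg[OF that f(1) _ x, of 1]) (auto simp: abs_le_iff intro: order_trans[of _ 0])
  have "(\<integral>y. f y \<partial>rsg M K a x) - (\<integral>y. f y \<partial>rsg M K b x) =
      (\<Sum>i\<in>UNIV. (a - b) $ i * (\<integral>y. f y \<partial>gibbs_step M K i x))"
    unfolding int[OF a] int[OF b]
    by (simp add: sum_subtractf left_diff_distrib)
  also have "\<bar>\<dots>\<bar> \<le> (\<Sum>i\<in>UNIV. \<bar>(a - b) $ i * (\<integral>y. f y \<partial>gibbs_step M K i x)\<bar>)"
    by (rule sum_abs)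
  also have "\<dots> \<le> (\<Sum>i\<in>UNIV. \<bar>(a - b) $ i\<bar>)"
    using integral_kernel_bounds(2)[OF measurable_gibbs_step x f]
    by (intro sum_mono) (auto simp: abs_mult intro!: mult_left_le)
  finally show ?thesis .
qed

section \<open>Stationarity of the target distribution\<close>

text \<open>The hypothesis \<open>cond\<close> identifies the joint law of \<open>x\<close> without
  coordinate \<open>i\<close> and of coordinate \<open>i\<close> with the one obtained by drawing
  that coordinate from \<open>K i\<close>. Gluing the coordinate back turns the first law into
  \<open>\<mu>\<close> and the second into the law after one update.\<close>

lemma gibbs_step_stationary:
  assumes \<mu>: "\<mu> \<in> space (prob_algebra S)"
    and cond: "\<And>A B. A \<in> sets (PiM (- {i}) M) \<Longrightarrow> B \<in> sets (M i) \<Longrightarrow>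
      emeasure \<mu> {x \<in> space \<mu>. restrict x (- {i}) \<in> A \<and> x i \<in> B} =
      (\<integral>\<^sup>+y\<in>A. emeasure (K i y) B \<partial>distr \<mu> (PiM (- {i}) M) (\<lambda>x. restrict x (- {i})))"
  shows "\<mu> \<bind> gibbs_step M K i = \<mu>"
proof -
  let ?Z = "PiM (- {i}) M"
  let ?r = "\<lambda>x. restrict x (- {i})"
  let ?\<rho> = "distr \<mu> ?Z ?r"
  let ?J = "\<lambda>z. distr (K i z) (?Z \<Otimes>\<^sub>M M i) (Pair z)"
  interpret prob_space \<mu> using \<mu> by (simp add: space_prob_algebra)
  have sets\<mu>[measurable_cong]: "sets \<mu> = sets S" using \<mu> by (simp add: space_prob_algebra)
  have sp\<mu>: "space \<mu> = space S" using sets\<mu> by (rule sets_eq_imp_space_eq)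
  have r[measurable]: "?r \<in> \<mu> \<rightarrow>\<^sub>M ?Z"
    using measurable_restrict_subset[of "- {i}" UNIV M] by (simp add: measurable_cong_sets[OF sets\<mu> refl])
  have T[measurable]: "(\<lambda>x. (?r x, x i)) \<in> \<mu> \<rightarrow>\<^sub>M ?Z \<Otimes>\<^sub>M M i"
    by measurable
  have U[measurable]: "(\<lambda>(z, y). z(i := y)) \<in> ?Z \<Otimes>\<^sub>M M i \<rightarrow>\<^sub>M S"
    unfolding case_prod_beta by (rule measurable_fun_upd[where J="- {i}"]) auto
  note measurable_K[measurable]
  have J: "?J \<in> ?Z \<rightarrow>\<^sub>M prob_algebra (?Z \<Otimes>\<^sub>M M i)"
    by measurable
  interpret \<rho>: prob_space ?\<rho> by (rule prob_space_distr[OF r])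
  have \<rho>: "?\<rho> \<in> space (prob_algebra ?Z)"
    using \<rho>.prob_space_axioms by (simp add: space_prob_algebra)
  \<comment> \<open>Rectangles form an intersection-stable generator, so it suffices to compare the
    two laws on them.\<close>
  have joint: "distr \<mu> (?Z \<Otimes>\<^sub>M M i) (\<lambda>x. (?r x, x i)) = ?\<rho> \<bind> ?J"
  proof (rule measure_eqI_generator_eq[OF Int_stable_pair_measure_generator, where \<Omega>="space ?Z \<times> space (M i)"])
    show "{a \<times> b |a b. a \<in> sets ?Z \<and> b \<in> sets (M i)} \<subseteq> Pow (space ?Z \<times> space (M i))"
      by (auto dest: sets.sets_into_space)
    show "sets (distr \<mu> (?Z \<Otimes>\<^sub>M M i) (\<lambda>x. (?r x, x i))) =
        sigma_sets (space ?Z \<times> space (M i)) {a \<times> b |a b. a \<in> sets ?Z \<and> b \<in> sets (M i)}"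
      by (simp add: sets_pair_measure)
    show "sets (?\<rho> \<bind> ?J) =
        sigma_sets (space ?Z \<times> space (M i)) {a \<times> b |a b. a \<in> sets ?Z \<and> b \<in> sets (M i)}"
      by (simp add: sets_bind'[OF \<rho> J] sets_pair_measure)
    show "range (\<lambda>_. space ?Z \<times> space (M i)) \<subseteq> {a \<times> b |a b. a \<in> sets ?Z \<and> b \<in> sets (M i)}"
      by blast
    show "emeasure (distr \<mu> (?Z \<Otimes>\<^sub>M M i) (\<lambda>x. (?r x, x i))) (space ?Z \<times> space (M i)) \<noteq> \<infinity>"
      using prob_space.emeasure_space_1[OF prob_space_distr[OF T]] by (simp add: space_pair_measure)
    fix X assume "X \<in> {a \<times> b |a b. a \<in> sets ?Z \<and> b \<in> sets (M i)}"
    then obtain A B where X: "X = A \<times> B" and A[measurable]: "A \<in> sets ?Z" and B[measurable]: "B \<in> sets (M i)"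
      by auto
    have X': "X \<in> sets (?Z \<Otimes>\<^sub>M M i)" unfolding X by measurable
    have "emeasure (distr \<mu> (?Z \<Otimes>\<^sub>M M i) (\<lambda>x. (?r x, x i))) X =
        emeasure \<mu> {x \<in> space \<mu>. ?r x \<in> A \<and> x i \<in> B}"
      by (subst emeasure_distr[OF T X']) (auto simp: X intro!: arg_cong[where f="emeasure \<mu>"])
    also have "\<dots> = (\<integral>\<^sup>+z. emeasure (K i z) B * indicator A z \<partial>?\<rho>)"
      by (rule cond[OF A B])
    also have "\<dots> = (\<integral>\<^sup>+z. emeasure (?J z) X \<partial>?\<rho>)"
    proof (rule nn_integral_cong)
      fix z assume "z \<in> space ?\<rho>"
      then have z: "z \<in> space ?Z" by simp
      have sK: "sets (K i z) = sets (M i)"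
        using measurable_space[OF measurable_K z] by (simp add: space_prob_algebra)
      have "Pair z \<in> M i \<rightarrow>\<^sub>M ?Z \<Otimes>\<^sub>M M i" using z by measurable
      then have P: "Pair z \<in> K i z \<rightarrow>\<^sub>M ?Z \<Otimes>\<^sub>M M i" by (simp add: measurable_cong_sets[OF sK refl])
      have "Pair z -` X \<inter> space (K i z) = (if z \<in> A then B else {})"
        using sets.sets_into_space[OF B] sets_eq_imp_space_eq[OF sK] by (auto simp: X)
      then show "emeasure (K i z) B * indicator A z = emeasure (?J z) X"
        by (simp add: emeasure_distr[OF P X'])
    qed
    also have "\<dots> = emeasure (?\<rho> \<bind> ?J) X"
      by (rule emeasure_bind_prob_algebra[OF \<rho> J X', symmetric])
    finally show "emeasure (distr \<mu> (?Z \<Otimes>\<^sub>M M i) (\<lambda>x. (?r x, x i))) X = emeasure (?\<rho> \<bind> ?J) X" .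
  qed auto
  have J': "?J \<in> ?\<rho> \<rightarrow>\<^sub>M subprob_algebra (?Z \<Otimes>\<^sub>M M i)"
    using measurable_prob_algebraD[OF J] by simp
  have JU: "(\<lambda>z. distr (?J z) S (\<lambda>(z, y). z(i := y))) \<in> ?Z \<rightarrow>\<^sub>M subprob_algebra S"
    using measurable_distr_prob_space2[OF J, of "\<lambda>_. \<lambda>(z, y). z(i := y)" S] U
    by (intro measurable_prob_algebraD) (simp add: case_prod_beta measurable_compose[OF measurable_snd])
  have "\<mu> = distr \<mu> S (\<lambda>x. (\<lambda>(z, y). z(i := y)) (?r x, x i))"
  proof -
    have "distr \<mu> S (\<lambda>x. (\<lambda>(z, y). z(i := y)) (?r x, x i)) = distr \<mu> \<mu> (\<lambda>x. x)"
      by (rule distr_cong) (auto simp: sets\<mu> fun_eq_iff)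
    then show ?thesis by simp
  qed
  also have "\<dots> = distr (?\<rho> \<bind> ?J) S (\<lambda>(z, y). z(i := y))"
    unfolding joint[symmetric] by (simp add: distr_distr[OF U T] comp_def)
  also have "\<dots> = ?\<rho> \<bind> (\<lambda>z. distr (?J z) S (\<lambda>(z, y). z(i := y)))"
    using \<rho>.not_empty by (intro distr_bind[OF J' _ U]) simp
  also have "\<dots> = \<mu> \<bind> (\<lambda>x. distr (?J (?r x)) S (\<lambda>(z, y). z(i := y)))"
    by (rule bind_distr[OF r JU not_empty])
  also have "\<dots> = \<mu> \<bind> gibbs_step M K i"
  proof (rule bind_cong[OF refl])
    fix x assume x: "x \<in> space \<mu>"
    then have z: "?r x \<in> space ?Z" by (rule measurable_space[OF r])
    have sK: "sets (K i (?r x)) = sets (M i)"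
      using measurable_space[OF measurable_K z] by (simp add: space_prob_algebra)
    have "Pair (?r x) \<in> M i \<rightarrow>\<^sub>M ?Z \<Otimes>\<^sub>M M i" using z by measurable
    then have P: "Pair (?r x) \<in> K i (?r x) \<rightarrow>\<^sub>M ?Z \<Otimes>\<^sub>M M i"
      by (simp add: measurable_cong_sets[OF sK refl])
    \<comment> \<open>Restriction alters \<open>x\<close> only at \<open>i\<close>, where the new
      value is written.\<close>
    have "(?r x)(i := y) = x(i := y)" for y
      by (auto simp: fun_eq_iff)
    then show "distr (?J (?r x)) S (\<lambda>(z, y). z(i := y)) = gibbs_step M K i x"
      by (simp add: distr_distr[OF U P] comp_def gibbs_step_def)
  qed
  finally show ?thesis by simp
qed

text \<open>A mixture of kernels that each preserve \<open>\<mu>\<close> preserves it too, as the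
  weights sum to 1.\<close>

lemma rsg_stationary:
  assumes \<mu>: "\<mu> \<in> space (prob_algebra S)" and cond: "full_conditionals M \<mu> K"
    and a: "a \<in> sel_simplex"
  shows "\<mu> \<bind> rsg M K a = \<mu>"
proof (rule measure_eqI)
  have sets: "sets \<mu> = sets S" using \<mu> by (simp add: space_prob_algebra)
  have stat: "\<mu> \<bind> gibbs_step M K i = \<mu>" for i
    using cond by (intro gibbs_step_stationary[OF \<mu>]) (simp add: full_conditionals_def)
  note P = measurable_rsg_fixed[OF a]
  show "sets (\<mu> \<bind> rsg M K a) = sets \<mu>"
    by (simp add: sets_bind'[OF \<mu> P] sets)
  fix A assume "A \<in> sets (\<mu> \<bind> rsg M K a)"
  then have A: "A \<in> sets S" by (simp add: sets_bind'[OF \<mu> P])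
  have meas: "(\<lambda>x. emeasure (gibbs_step M K i x) A) \<in> borel_measurable \<mu>" for i
    using measurable_emeasure_kernel[OF measurable_prob_algebraD[OF measurable_gibbs_step] A]
    by (simp add: measurable_cong_sets[OF sets refl])
  have "emeasure (\<mu> \<bind> rsg M K a) A = (\<integral>\<^sup>+x. emeasure (rsg M K a x) A \<partial>\<mu>)"
    by (rule emeasure_bind_prob_algebra[OF \<mu> P A])
  also have "\<dots> = (\<integral>\<^sup>+x. (\<Sum>i\<in>UNIV. ennreal (a $ i) * emeasure (gibbs_step M K i x) A) \<partial>\<mu>)"
    using sets_eq_imp_space_eq[OF sets] by (intro nn_integral_cong emeasure_rsg[OF A]) simp
  also have "\<dots> = (\<Sum>i\<in>UNIV. ennreal (a $ i) * (\<integral>\<^sup>+x. emeasure (gibbs_step M K i x) A \<partial>\<mu>))"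
    using meas by (simp add: nn_integral_sum nn_integral_cmult)
  also have "\<dots> = (\<Sum>i\<in>UNIV. ennreal (a $ i) * emeasure \<mu> A)"
    by (simp add: emeasure_bind_prob_algebra[OF \<mu> measurable_gibbs_step A, symmetric] stat)
  also have "\<dots> = emeasure \<mu> A"
    using a by (simp add: sum_distrib_right[symmetric] sum_ennreal sel_simplex_def)
  finally show "emeasure (\<mu> \<bind> rsg M K a) A = emeasure \<mu> A" .
qed

end

section \<open>Trajectories of the adaptive chain\<close>

context Ionescu_Tulcea
begin

text \<open>The total mass is read off from the marginal on the empty index set.\<close>

lemma prob_space_lim: "prob_space PF.lim"
proof (rule prob_space_distrD)
  show "(\<lambda>x. restrict x {}) \<in> PF.lim \<rightarrow>\<^sub>M PiM {} M"
    by (simp add: measurable_cong_sets[OF PF.sets_lim refl] measurable_restrict_subset)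
  show "prob_space (distr PF.lim (PiM {} M) (\<lambda>x. restrict x {}))"
    by (simp add: distr_lim PF.prob_space_P)
qed

text \<open>\<open>CI J\<close> runs the chain up to the least strict upper bound
  \<open>up_to J\<close> and then restricts to \<open>J\<close>. For an initial segment that bound
  is \<open>n\<close>, so the restriction does nothing.\<close>

lemma distr_lim_restrict:
  "distr PF.lim (PiM {0..<n} M) (\<lambda>\<omega>. restrict \<omega> {0..<n}) = C 0 n (\<lambda>_. undefined)"
proof -
  have "up_to {0..<n} \<le> n" by (simp add: up_to_iff_Ico)
  moreover have "n \<le> up_to {0..<n}" using up_to[of "{0..<n}"] by (cases "n = 0") simp_all
  ultimately have "up_to {0..<n} = n" by simp
  then show ?thesis
    using distr_C[of n n "\<lambda>_. undefined" 0] by (simp add: distr_lim CI_def)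
qed

text \<open>Conditioning on the first \<open>n\<close> states: \<open>C 0 (Suc n)\<close> is
  \<open>C 0 n\<close> followed by \<open>eP n\<close>, and both laws are marginals of the limit
  measure.\<close>

lemma integral_lim_step:
  fixes f :: "_ \<Rightarrow> real"
  assumes f: "f \<in> borel_measurable (PiM {0..<Suc n} M)"
    and bnd: "\<And>z. z \<in> space (PiM {0..<Suc n} M) \<Longrightarrow> \<bar>f z\<bar> \<le> B"
  shows "(\<integral>\<omega>. f (restrict \<omega> {0..<Suc n}) \<partial>PF.lim) =
    (\<integral>\<omega>. \<integral>y. f ((restrict \<omega> {0..<n})(n := y)) \<partial>P n (restrict \<omega> {0..<n}) \<partial>PF.lim)"
proof -
  \<comment> \<open>The empty history, the only point of the product over the empty index
    set.\<close>
  let ?u = "\<lambda>_ :: nat. undefined"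
  have u: "?u \<in> space (PiM {0..<0} M)" by (simp add: space_PiM)
  have r: "(\<lambda>\<omega>. restrict \<omega> {0..<k}) \<in> PF.lim \<rightarrow>\<^sub>M PiM {0..<k} M" for k
    by (simp add: measurable_cong_sets[OF PF.sets_lim refl] measurable_restrict_subset)
  have C: "C 0 n ?u \<in> space (prob_algebra (PiM {0..<n} M))"
    using prob_space_C[OF u, of n] sets_C[OF u, of n] by (simp add: space_prob_algebra)
  have eP: "eP n \<in> PiM {0..<n} M \<rightarrow>\<^sub>M prob_algebra (PiM {0..<Suc n} M)"
    by (intro measurable_prob_algebraI prob_space_eP measurable_eP)
  have "(\<integral>\<omega>. f (restrict \<omega> {0..<Suc n}) \<partial>PF.lim) = (\<integral>z. f z \<partial>C 0 (Suc n) ?u)"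
    unfolding distr_lim_restrict[symmetric] by (rule integral_distr[OF r f, symmetric])
  also have "\<dots> = (\<integral>z. \<integral>y. f y \<partial>eP n z \<partial>C 0 n ?u)"
    using integral_bind_prob_algebra[OF C eP f bnd] by simp
  also have "\<dots> = (\<integral>\<omega>. \<integral>y. f y \<partial>eP n (restrict \<omega> {0..<n}) \<partial>PF.lim)"
    unfolding distr_lim_restrict[symmetric]
    by (rule integral_distr[OF r measurable_integral_kernel[OF eP f]])
  also have "\<dots> = (\<integral>\<omega>. \<integral>y. f ((restrict \<omega> {0..<n})(n := y)) \<partial>P n (restrict \<omega> {0..<n}) \<partial>PF.lim)"
  proof (rule Bochner_Integration.integral_cong[OF refl])
    fix \<omega> assume "\<omega> \<in> space PF.lim"
    then have z: "restrict \<omega> {0..<n} \<in> space (PiM {0..<n} M)"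
      by (rule measurable_space[OF r])
    have "fun_upd (restrict \<omega> {0..<n}) n \<in>
        P n (restrict \<omega> {0..<n}) \<rightarrow>\<^sub>M PiM {0..<Suc n} M"
      unfolding measurable_cong_sets[OF sets_P[OF z] refl]
      using z by (intro measurable_fun_upd[where J="{0..<n}"]) auto
    then show "(\<integral>y. f y \<partial>eP n (restrict \<omega> {0..<n})) =
        (\<integral>y. f ((restrict \<omega> {0..<n})(n := y)) \<partial>P n (restrict \<omega> {0..<n}))"
      unfolding eP_def by (rule integral_distr[OF _ f])
  qed
  finally show ?thesis .
qed

end

text \<open>Predictability of the selection probabilities, which allows them to be evaluated on any
  truncated history that is long enough.\<close>

lemma adap_sel_cong:
  assumes "\<And>i. i < n \<Longrightarrow> \<omega> i = \<omega>' i"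
  shows "adap_sel R a0 n \<omega> = adap_sel R a0 n \<omega>'"
  using assms
proof (induction n)
  case (Suc n)
  have "restrict \<omega> {0..<Suc n} = restrict \<omega>' {0..<Suc n}"
    using Suc.prems by (intro restrict_ext) simp
  with Suc show ?case by simp
qed simp

text \<open>One pair of starting values is fixed, since every pair has a trajectory measure of its
  own.\<close>

locale adaptive_chain = gibbs_kernels M K
  for M :: "'d::finite \<Rightarrow> 'a measure" and K :: "'d \<Rightarrow> ('d \<Rightarrow> 'a) \<Rightarrow> 'a measure" +
  fixes Y :: "(real^'d) set"
    and R :: "nat \<Rightarrow> real^'d \<Rightarrow> (nat \<Rightarrow> 'd \<Rightarrow> 'a) \<Rightarrow> real^'d"
    and x0 :: "'d \<Rightarrow> 'a" and a0 :: "real^'d"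
  assumes Y: "Y \<subseteq> sel_simplex" and rule: "update_rule S Y R"
    and x0: "x0 \<in> space S" and a0: "a0 \<in> Y"
begin

abbreviation \<alpha> :: "nat \<Rightarrow> (nat \<Rightarrow> 'd \<Rightarrow> 'a) \<Rightarrow> real^'d" where "\<alpha> n \<omega> \<equiv> adap_sel R a0 n \<omega>"

text \<open>The index set \<open>J\<close> is left open so that the fact serves finite histories and
  whole trajectories alike.\<close>

lemma measurable_adap_sel:
  assumes "{0..<n} \<subseteq> J"
  shows "(\<lambda>\<omega>. \<alpha> n \<omega>) \<in> PiM J (\<lambda>_. S) \<rightarrow>\<^sub>M restrict_space borel Y"
  using assms
proof (induction n)
  case 0
  show ?case using a0 by (simp add: space_restrict_space)
next
  case (Suc n)
  have "(\<lambda>\<omega>. (\<alpha> n \<omega>, restrict \<omega> {0..<Suc n})) \<in>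
      PiM J (\<lambda>_. S) \<rightarrow>\<^sub>M restrict_space borel Y \<Otimes>\<^sub>M PiM {0..<Suc n} (\<lambda>_. S)"
    using Suc by (intro measurable_Pair measurable_restrict_subset Suc.IH) auto
  moreover have "(\<lambda>(a, h). R (Suc n) a h) \<in>
      restrict_space borel Y \<Otimes>\<^sub>M PiM {0..<Suc n} (\<lambda>_. S) \<rightarrow>\<^sub>M restrict_space borel Y"
    using rule unfolding update_rule_def by (elim allE[of _ "Suc n"]) simp
  ultimately have "(\<lambda>\<omega>. case (\<alpha> n \<omega>, restrict \<omega> {0..<Suc n}) of (a, h) \<Rightarrow> R (Suc n) a h) \<in>
      PiM J (\<lambda>_. S) \<rightarrow>\<^sub>M restrict_space borel Y"
    by (rule measurable_compose)
  then show ?case by simp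
qed

lemma adap_sel_in: "\<omega> \<in> space (PiM UNIV (\<lambda>_ :: nat. S)) \<Longrightarrow> \<alpha> n \<omega> \<in> Y"
  using measurable_space[OF measurable_adap_sel[OF subset_UNIV]] by (simp add: space_restrict_space)

lemma measurable_adap_step:
  "adap_step M K R x0 a0 n \<in> PiM {0..<n} (\<lambda>_. S) \<rightarrow>\<^sub>M prob_algebra S"
proof (cases n)
  case 0
  have "return S x0 \<in> space (prob_algebra S)"
    using x0 by (simp add: space_prob_algebra prob_space_return)
  then show ?thesis by (simp add: 0 cong: measurable_cong)
next
  case (Suc m)
  have "(\<lambda>\<omega>. (\<alpha> (Suc m) \<omega>, \<omega> m)) \<in>
      PiM {0..<Suc m} (\<lambda>_. S) \<rightarrow>\<^sub>M restrict_space borel Y \<Otimes>\<^sub>M S"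
    by (intro measurable_Pair measurable_adap_sel measurable_component_singleton) auto
  from measurable_compose[OF this measurable_rsg[OF Y]] show ?thesis
    unfolding Suc by (simp cong: measurable_cong del: adap_sel.simps)
qed

sublocale IT: Ionescu_Tulcea "adap_step M K R x0 a0" "\<lambda>_. S"
proof (rule Ionescu_Tulcea.intro)
  show "adap_step M K R x0 a0 n \<in> PiM {0..<n} (\<lambda>_. S) \<rightarrow>\<^sub>M subprob_algebra S" for n
    by (rule measurable_prob_algebraD[OF measurable_adap_step])
  show "prob_space (adap_step M K R x0 a0 n \<omega>)" if "\<omega> \<in> space (PiM {0..<n} (\<lambda>_. S))" for n \<omega>
    using measurable_space[OF measurable_adap_step that] by (simp add: space_prob_algebra)
qed

abbreviation traj :: "(nat \<Rightarrow> 'd \<Rightarrow> 'a) measure" where "traj \<equiv> adap_traj M K R x0 a0"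

lemma traj_eq: "traj = IT.PF.lim"
  by (simp add: adap_traj_def)

sublocale traj: prob_space traj
  unfolding traj_eq by (rule IT.prob_space_lim)

lemma sets_traj: "sets traj = sets (PiM UNIV (\<lambda>_. S))"
  by (simp add: traj_eq)

lemma space_traj: "space traj = space (PiM UNIV (\<lambda>_. S))"
  by (rule sets_eq_imp_space_eq[OF sets_traj])

lemma measurable_traj:
  "(\<lambda>\<omega>. \<alpha> n \<omega>) \<in> traj \<rightarrow>\<^sub>M restrict_space borel Y" "(\<lambda>\<omega>. \<omega> n) \<in> traj \<rightarrow>\<^sub>M S"
  unfolding measurable_cong_sets[OF sets_traj refl]
  by (auto intro: measurable_adap_sel measurable_component_singleton)

lemma measurable_adap_sel_borel: "(\<lambda>\<omega>. \<alpha> n \<omega>) \<in> borel_measurable traj"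
  using measurable_traj(1) by (rule measurable_restrict_space2_iff[THEN iffD1, THEN conjunct1])

text \<open>By predictability and \<open>m \<le> Suc n\<close>, \<open>\<alpha> m\<close> is
  determined by the states up to time \<open>n\<close>, so it stays fixed while the next state is
  drawn.\<close>

lemma integral_traj_step:
  fixes g :: "real^'d \<Rightarrow> ('d \<Rightarrow> 'a) \<Rightarrow> real"
  assumes g: "(\<lambda>(a, x). g a x) \<in> borel_measurable (restrict_space borel Y \<Otimes>\<^sub>M S)"
    and bnd: "\<And>a x. a \<in> Y \<Longrightarrow> x \<in> space S \<Longrightarrow> \<bar>g a x\<bar> \<le> B"
    and m: "m \<le> Suc n"
  shows "(\<integral>\<omega>. g (\<alpha> m \<omega>) (\<omega> (Suc n)) \<partial>traj) =
    (\<integral>\<omega>. \<integral>y. g (\<alpha> m \<omega>) y \<partial>rsg M K (\<alpha> (Suc n) \<omega>) (\<omega> n) \<partial>traj)"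
proof -
  let ?f = "\<lambda>z. g (\<alpha> m z) (z (Suc n))" and ?I = "{0..<Suc (Suc n)}"
  have pair: "(\<lambda>z. (\<alpha> m z, z (Suc n))) \<in>
      PiM ?I (\<lambda>_. S) \<rightarrow>\<^sub>M restrict_space borel Y \<Otimes>\<^sub>M S"
    using m by (intro measurable_Pair measurable_adap_sel measurable_component_singleton) auto
  have f: "?f \<in> borel_measurable (PiM ?I (\<lambda>_. S))"
    using measurable_compose[OF pair g] by simp
  have f_bnd: "\<bar>?f z\<bar> \<le> B" if "z \<in> space (PiM ?I (\<lambda>_. S))" for z
    using measurable_space[OF pair that] by (intro bnd) (auto simp: space_pair_measure space_restrict_space)
  have r: "\<alpha> k (restrict \<omega> {0..<l}) = \<alpha> k \<omega>" if "k \<le> l" for k l \<omega>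
    using that by (intro adap_sel_cong) simp
  have u: "\<alpha> m (restrict (fun_upd \<omega> (Suc n) y) (insert (Suc n) {0..<Suc n})) = \<alpha> m \<omega>" for \<omega> y
    using m by (intro adap_sel_cong) simp
  show ?thesis
    using IT.integral_lim_step[OF f f_bnd] m
    by (simp add: traj_eq[symmetric] r u del: adap_sel.simps)
qed

end

section \<open>Comparison with a frozen kernel\<close>

lemma sum_abs_diff_simplex:
  fixes a b :: "real^'d"
  assumes "a \<in> sel_simplex" "b \<in> sel_simplex"
  shows "(\<Sum>i\<in>UNIV. \<bar>(a - b) $ i\<bar>) \<le> 2"
proof -
  have "(\<Sum>i\<in>UNIV. \<bar>(a - b) $ i\<bar>) \<le> (\<Sum>i\<in>UNIV. a $ i + b $ i)"
  proof (rule sum_mono)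
    fix i
    have "0 \<le> a $ i" "0 \<le> b $ i" using assms by (auto simp: sel_simplex_def)
    then show "\<bar>(a - b) $ i\<bar> \<le> a $ i + b $ i" by simp
  qed
  also have "\<dots> = 2"
    using assms by (simp add: sum.distrib sel_simplex_def)
  finally show ?thesis .
qed

lemma sum_abs_le_norm: "(\<Sum>i\<in>UNIV. \<bar>v $ i\<bar>) \<le> real CARD('d) * norm (v :: real^'d)"
  using sum_bounded_above[of UNIV "\<lambda>i. \<bar>v $ i\<bar>" "norm v"] by (simp add: component_le_norm_cart)

context adaptive_chain
begin

lemma change_event_sets:
  "{\<omega> \<in> space traj. \<delta> < norm (\<alpha> (Suc n) \<omega> - \<alpha> n \<omega>)} \<in> sets traj"
  using measurable_adap_sel_borel[of n] measurable_adap_sel_borel[of "Suc n"] by measurable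

text \<open>Triangle inequality over the \<open>k\<close> increments. An increment of norm at most
  \<open>\<delta>\<close> has coordinate sum at most \<open>CARD('d) * \<delta>\<close>; on the
  exceptional event the bound 2 for two points of the simplex is used. Taking means turns the
  indicators into \<open>adap_change_prob\<close>.\<close>

lemma sum_abs_adap_sel_diff:
  fixes \<delta> :: real
  assumes \<omega>: "\<omega> \<in> space traj" and "0 \<le> \<delta>"
  shows "(\<Sum>i\<in>UNIV. \<bar>(\<alpha> (n + k) \<omega> - \<alpha> n \<omega>) $ i\<bar>) \<le>
    (\<Sum>j<k. real CARD('d) * \<delta> +
      2 * indicator {\<omega> \<in> space traj. \<delta> < norm (\<alpha> (Suc (n + j)) \<omega> - \<alpha> (n + j) \<omega>)} \<omega>)"
proof (induction k)
  case (Suc k)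
  let ?a = "\<alpha> (Suc (n + k)) \<omega>" and ?b = "\<alpha> (n + k) \<omega>" and ?c = "\<alpha> n \<omega>"
  have ab: "?a \<in> sel_simplex" "?b \<in> sel_simplex"
    using adap_sel_in \<omega> Y unfolding space_traj by blast+
  have "(\<Sum>i\<in>UNIV. \<bar>(?a - ?b) $ i\<bar>) \<le> real CARD('d) * \<delta> +
      2 * indicator {\<omega> \<in> space traj. \<delta> < norm (\<alpha> (Suc (n + k)) \<omega> - \<alpha> (n + k) \<omega>)} \<omega>"
  proof (cases "\<delta> < norm (?a - ?b)")
    case True
    have "0 \<le> real CARD('d) * \<delta>" using \<open>0 \<le> \<delta>\<close> by simp
    then show ?thesis
      using True \<omega> sum_abs_diff_simplex[OF ab] by (simp del: adap_sel.simps)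
  next
    case False
    then have "real CARD('d) * norm (?a - ?b) \<le> real CARD('d) * \<delta>"
      by (intro mult_left_mono) (simp_all del: adap_sel.simps)
    from order_trans[OF sum_abs_le_norm this] False show ?thesis
      by (simp del: adap_sel.simps)
  qed
  moreover have "(\<Sum>i\<in>UNIV. \<bar>(?a - ?c) $ i\<bar>) \<le>
      (\<Sum>i\<in>UNIV. \<bar>(?b - ?c) $ i\<bar>) + (\<Sum>i\<in>UNIV. \<bar>(?a - ?b) $ i\<bar>)"
    unfolding sum.distrib[symmetric] by (intro sum_mono) (simp del: adap_sel.simps)
  ultimately show ?case
    using Suc by (simp del: adap_sel.simps)
qed simp

text \<open>The error \<open>c\<close> is that of the kernel frozen at time \<open>n\<close>.
  Replacing frozen steps by adaptive ones takes \<open>N\<close> exchanges, each costing at most the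
  accumulated change over the whole window; hence the factor \<open>N\<close> before the
  sum.\<close>

lemma integral_law_diff_le:
  fixes f :: "('d \<Rightarrow> 'a) \<Rightarrow> real" and p c \<delta> :: real
  assumes f: "f \<in> borel_measurable S" "\<And>x. x \<in> space S \<Longrightarrow> f x \<in> {0..1}"
    and conv: "\<And>a x. a \<in> Y \<Longrightarrow> x \<in> space S \<Longrightarrow>
      \<bar>(\<integral>y. f y \<partial>kernel_pow S (rsg M K a) N x) - p\<bar> \<le> c"
    and \<delta>: "0 \<le> \<delta>"
  shows "\<bar>(\<integral>\<omega>. f (\<omega> (n + N)) \<partial>traj) - p\<bar> \<le>
    c + N * (\<Sum>j<N. real CARD('d) * \<delta> + 2 * adap_change_prob M K R x0 a0 \<delta> (n + j))"
proof -
  let ?Y = "restrict_space borel Y :: (real^'d) measure"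
  let ?D = "\<lambda>j. real CARD('d) * \<delta> + 2 * adap_change_prob M K R x0 a0 \<delta> (n + j)"
  define T where "T = (\<Sum>j<N. ?D j)"
  define G where "G j a x = (\<integral>y. f y \<partial>kernel_pow S (rsg M K a) j x)" for j a x
  note P = measurable_rsg_fixed[OF subsetD[OF Y]]
  have f_abs: "\<bar>f x\<bar> \<le> 1" if "x \<in> space S" for x
    using f(2)[OF that] by auto
  have G_meas: "(\<lambda>(a, x). G j a x) \<in> borel_measurable (?Y \<Otimes>\<^sub>M S)" for j
    using measurable_integral_kernel[OF measurable_kernel_pow_param[OF measurable_rsg[OF Y]] f(1)]
    by (simp add: G_def case_prod_beta)
  have G01: "G j a x \<in> {0..1}" if "a \<in> Y" "x \<in> space S" for j a x
    unfolding G_def using integral_kernel_bounds(2)[OF measurable_kernel_pow[OF P[OF that(1)]] that(2) f] .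
  have G_abs: "\<bar>G j a x\<bar> \<le> 1" if "a \<in> Y" "x \<in> space S" for j a x
    using G01[OF that, of j] by auto
  \<comment> \<open>Splits off the first step, whereas the recursion of \<open>kernel_pow\<close>
    splits off the last.\<close>
  have G_Suc: "G (Suc j) a x = (\<integral>y. G j a y \<partial>rsg M K a x)" if a: "a \<in> Y" and x: "x \<in> space S" for j a x
  proof -
    have "kernel_pow S (rsg M K a) 1 x = rsg M K a x"
      using bind_return[OF measurable_prob_algebraD[OF P[OF a]] x] by simp
    then show ?thesis
      using integral_kernel_pow_add[OF P[OF a] x f(1) f_abs, of 1 j] by (simp add: G_def)
  qed
  have in_Y: "\<alpha> k \<omega> \<in> Y" and in_S: "\<omega> k \<in> space S" if "\<omega> \<in> space traj" for k \<omega>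
    using adap_sel_in that measurable_space[OF measurable_traj(2) that] by (auto simp: space_traj)
  have G_traj: "(\<lambda>\<omega>. G j (\<alpha> n \<omega>) (\<omega> k)) \<in> borel_measurable traj" for j k
    using measurable_compose[OF measurable_Pair[OF measurable_traj(1)[of n] measurable_traj(2)[of k]] G_meas[of j]]
    by simp
  \<comment> \<open>\<open>E k\<close> belongs to a hybrid: the chain adapts up to time
    \<open>n + k\<close>, then the kernel frozen at \<open>\<alpha> n\<close> runs for the remaining
    steps. \<open>E 0\<close> is frozen from time \<open>n\<close> on, and \<open>E N\<close> is
    fully adaptive.\<close>
  define E where "E k = (\<integral>\<omega>. G (N - k) (\<alpha> n \<omega>) (\<omega> (n + k)) \<partial>traj)" for k
  have D_nonneg: "0 \<le> ?D j" for j
    using \<delta> by (simp add: adap_change_prob_def)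
  have step: "\<bar>E (Suc k) - E k\<bar> \<le> T" if "k < N" for k
  proof -
    define j where "j = N - Suc k"
    have j: "N - k = Suc j" using that by (simp add: j_def)
    let ?I = "\<lambda>a \<omega>. \<integral>y. G j (\<alpha> n \<omega>) y \<partial>rsg M K a (\<omega> (n + k))"
    \<comment> \<open>Both hybrids integrate the same function after one step from the state at time
      \<open>n + k\<close>; they differ only in whether this step uses
      \<open>\<alpha> (Suc (n + k))\<close> or \<open>\<alpha> n\<close>.\<close>
    let ?A = "\<lambda>\<omega>. ?I (\<alpha> (Suc (n + k)) \<omega>) \<omega>" and ?B = "\<lambda>\<omega>. G (Suc j) (\<alpha> n \<omega>) (\<omega> (n + k))"
    let ?H = "\<lambda>\<omega>. \<Sum>j<Suc k. real CARD('d) * \<delta> +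
      2 * indicator {\<omega> \<in> space traj. \<delta> < norm (\<alpha> (Suc (n + j)) \<omega> - \<alpha> (n + j) \<omega>)} \<omega>"
    have E_Suc: "E (Suc k) = (\<integral>\<omega>. ?A \<omega> \<partial>traj)"
      using integral_traj_step[OF G_meas G_abs, of n "n + k" j]
      by (simp add: E_def j_def[symmetric] del: adap_sel.simps)
    have E_k: "E k = (\<integral>\<omega>. ?B \<omega> \<partial>traj)"
      by (simp add: E_def j)
    have pair: "(\<lambda>\<omega>. (\<alpha> (Suc (n + k)) \<omega>, \<omega> (n + k))) \<in> traj \<rightarrow>\<^sub>M ?Y \<Otimes>\<^sub>M S"
      by (rule measurable_Pair[OF measurable_traj])
    have L: "(\<lambda>\<omega>. rsg M K (\<alpha> (Suc (n + k)) \<omega>) (\<omega> (n + k))) \<in> traj \<rightarrow>\<^sub>M prob_algebra S"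
      using measurable_compose[OF pair measurable_rsg[OF Y]] by (simp del: adap_sel.simps)
    have "(\<lambda>q. (\<alpha> n (fst q), snd q)) \<in> traj \<Otimes>\<^sub>M S \<rightarrow>\<^sub>M ?Y \<Otimes>\<^sub>M S"
      by (intro measurable_Pair measurable_compose[OF measurable_fst measurable_traj(1)] measurable_snd)
    from measurable_compose[OF this G_meas[of j]]
    have A_meas: "?A \<in> borel_measurable traj"
      by (intro measurable_integral_prob_algebra2[OF _ L]) (simp add: case_prod_beta)
    have G_sect: "G j a \<in> borel_measurable S" if "a \<in> Y" for a
      using measurable_Pair2[OF G_meas[of j], of a] that by (simp add: space_restrict_space)
    have A01: "?A \<omega> \<in> {0..1}" if "\<omega> \<in> space traj" for \<omega>
      by (rule integral_kernel_bounds(2)[OF P[OF in_Y[OF that]] in_S[OF that] G_sect[OF in_Y[OF that]]])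
        (rule G01[OF in_Y[OF that]])
    have A_int: "integrable traj ?A"
      by (rule integral_prob_bounds(1)[where l=0 and u=1, OF traj.prob_space_axioms A_meas]) (use A01 in auto)
    have B_int: "integrable traj ?B"
      by (rule integral_prob_bounds(1)[where l=0 and u=1, OF traj.prob_space_axioms G_traj])
        (use G01[OF in_Y in_S] in auto)
    have AB: "\<bar>?A \<omega> - ?B \<omega>\<bar> \<le> ?H \<omega>" if \<omega>: "\<omega> \<in> space traj" for \<omega>
    proof -
      have "?B \<omega> = ?I (\<alpha> n \<omega>) \<omega>"
        by (rule G_Suc[OF in_Y[OF \<omega>] in_S[OF \<omega>]])
      then have "\<bar>?A \<omega> - ?B \<omega>\<bar> \<le> (\<Sum>i\<in>UNIV. \<bar>(\<alpha> (n + Suc k) \<omega> - \<alpha> n \<omega>) $ i\<bar>)"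
        using integral_rsg_diff_le[of "\<alpha> (Suc (n + k)) \<omega>" "\<alpha> n \<omega>" "G j (\<alpha> n \<omega>)" "\<omega> (n + k)"]
          in_Y[OF \<omega>] in_S[OF \<omega>] Y G_sect G01
        by (simp add: subset_iff del: adap_sel.simps)
      also have "\<dots> \<le> ?H \<omega>"
        by (rule sum_abs_adap_sel_diff[OF \<omega> \<delta>])
      finally show ?thesis .
    qed
    have H: "integrable traj ?H" "(\<integral>\<omega>. ?H \<omega> \<partial>traj) = (\<Sum>j<Suc k. ?D j)"
      using change_event_sets
      by (simp_all add: adap_change_prob_def traj.prob_space traj.emeasure_eq_measure
          Bochner_Integration.integral_sum del: adap_sel.simps sum.lessThan_Suc)
    have "\<bar>E (Suc k) - E k\<bar> = \<bar>\<integral>\<omega>. ?A \<omega> - ?B \<omega> \<partial>traj\<bar>"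
      unfolding E_Suc E_k Bochner_Integration.integral_diff[OF A_int B_int] ..
    also have "\<dots> \<le> (\<integral>\<omega>. \<bar>?A \<omega> - ?B \<omega>\<bar> \<partial>traj)"
      by (rule integral_abs_bound)
    also have "\<dots> \<le> (\<integral>\<omega>. ?H \<omega> \<partial>traj)"
      using AB A_int B_int H(1) by (intro integral_mono) auto
    \<comment> \<open>Adding the remaining nonnegative terms of the window makes the bound
      independent of \<open>k\<close>.\<close>
    also have "\<dots> \<le> T"
      unfolding H(2) T_def using that D_nonneg by (intro sum_mono2) auto
    finally show ?thesis .
  qed
  have "\<bar>E k - E 0\<bar> \<le> k * T" if "k \<le> N" for k
    using that
  proof (induction k)
    case (Suc k)
    with step[of k] show ?case by (simp add: distrib_right)
  qed simp
  from this[of N] have "\<bar>E N - E 0\<bar> \<le> N * T" by simp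
  moreover have "E N = (\<integral>\<omega>. f (\<omega> (n + N)) \<partial>traj)"
    unfolding E_def using in_S f(1)
    by (intro Bochner_Integration.integral_cong) (simp_all add: G_def integral_return)
  moreover have "\<bar>E 0 - p\<bar> \<le> c"
  proof -
    \<comment> \<open>\<open>conv\<close> holds for every parameter in \<open>Y\<close> and every
      state, so it applies to the random pair pathwise and survives integration.\<close>
    have "G N (\<alpha> n \<omega>) (\<omega> n) \<in> {p - c..p + c}" if "\<omega> \<in> space traj" for \<omega>
      using conv[OF in_Y[OF that] in_S[OF that], of n n] by (auto simp: G_def abs_le_iff)
    then have "E 0 \<in> {p - c..p + c}"
      using integral_prob_bounds(2,3)[where l="p - c" and u="p + c", OF traj.prob_space_axioms G_traj[of N n]]
      by (simp add: E_def)
    then show ?thesis by (auto simp: abs_le_iff)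
  qed
  ultimately show ?thesis
    unfolding T_def by linarith
qed

end

section \<open>Convergence of the adaptive sampler\<close>

text \<open>\<open>uniformly_ergodic\<close> iterates with the target measure as reference space;
  only its sigma-algebra matters.\<close>

lemma kernel_pow_cong_sets:
  assumes "sets \<mu> = sets S"
  shows "kernel_pow \<mu> P n x = kernel_pow S P n x"
  by (induction n) (simp_all add: return_cong[OF assms])

lemma tv_dist_nonneg:
  assumes "prob_space \<mu>" "prob_space \<nu>"
  shows "0 \<le> tv_dist \<mu> \<nu>"
  using tv_dist_upper[OF assms sets.empty_sets] by simp

lemma uniformly_ergodicE:
  assumes ue: "uniformly_ergodic \<mu> P" and \<mu>: "\<mu> \<in> space (prob_algebra S)"
    and "0 < e"
  obtains m where "\<And>x. x \<in> space S \<Longrightarrow> tv_dist (kernel_pow S P m x) \<mu> \<le> e"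
proof -
  have sets: "sets \<mu> = sets S" and prob: "prob_space \<mu>"
    using \<mu> by (auto simp: space_prob_algebra)
  note sp = sets_eq_imp_space_eq[OF sets]
  from ue obtain C \<rho> where "\<rho> < 1"
    and tv: "\<And>x n. x \<in> space S \<Longrightarrow> tv_dist (kernel_pow S P n x) \<mu> \<le> C * \<rho> ^ n"
    unfolding uniformly_ergodic_def kernel_pow_cong_sets[OF sets] sp by blast
  have "\<exists>m. C * \<rho> ^ m \<le> e"
  proof (cases "0 \<le> \<rho>")
    case True
    then have "(\<lambda>n. C * \<rho> ^ n) \<longlonglongrightarrow> C * 0"
      using \<open>\<rho> < 1\<close> by (intro tendsto_mult tendsto_const LIMSEQ_realpow_zero)
    then have "\<forall>\<^sub>F n in sequentially. C * \<rho> ^ n < e"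
      using \<open>0 < e\<close> by (intro order_tendstoD) auto
    then show ?thesis
      by (auto simp: eventually_sequentially intro: less_imp_le)
  next
    \<comment> \<open>The definition admits a negative \<open>\<rho>\<close>, whose powers may fail
      to vanish. Time 0 then forces \<open>0 \<le> C\<close>, and the bound at time 1 is at most
      0.\<close>
    case False
    obtain x where x: "x \<in> space S"
      using prob_space.not_empty[OF prob] sp by auto
    have "prob_space (kernel_pow S P 0 x)"
      using x by (simp add: prob_space_return)
    from order_trans[OF tv_dist_nonneg[OF this prob] tv[OF x]] have "0 \<le> C" by simp
    with False have "C * \<rho> ^ 1 \<le> 0" by (simp add: mult_nonneg_nonpos)
    with \<open>0 < e\<close> show ?thesis by (intro exI[of _ 1]) simp
  qed
  with tv show ?thesis
    by (meson order_trans that)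
qed

text \<open>The order of choices matters: \<open>q\<close> makes the geometric term small and fixes
  the window length, then \<open>\<delta>\<close> is chosen for that window, and only then does
  \<open>n\<close> tend to infinity.\<close>

lemma tendsto_zero_of_block_bound:
  fixes T :: "nat \<Rightarrow> real" and p :: "real \<Rightarrow> nat \<Rightarrow> real"
  assumes T: "\<And>n. 0 \<le> T n" and \<gamma>: "0 \<le> \<gamma>" "\<gamma> < 1" and "0 \<le> d"
    and bound: "\<And>n q \<delta>. 0 < \<delta> \<Longrightarrow>
      T (n + m * q) \<le> \<gamma> ^ q + real (m * q) * (\<Sum>j<m * q. d * \<delta> + 2 * p \<delta> (n + j))"
    and p: "\<And>\<delta>. 0 < \<delta> \<Longrightarrow> p \<delta> \<longlonglongrightarrow> 0"
  shows "T \<longlonglongrightarrow> 0"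
proof (rule order_tendstoI)
  show "\<forall>\<^sub>F n in sequentially. x < T n" if "x < 0" for x
    using that T by (intro always_eventually allI) (rule less_le_trans)
  fix e :: real assume "0 < e"
  obtain q where q: "\<gamma> ^ q < e / 2"
    using real_arch_pow_inv[of "e / 2" \<gamma>] \<gamma> \<open>0 < e\<close> by auto
  define N where "N = m * q"
  \<comment> \<open>The deterministic part of the bound is \<open>(c - 1) * \<delta>\<close>; the
    added 1 keeps \<open>c\<close> positive for an empty window and makes the estimate by
    \<open>e / 2\<close> strict.\<close>
  define c where "c = real N * (real N * d) + 1"
  define \<delta> where "\<delta> = e / (2 * c)"
  have "0 < c" using \<open>0 \<le> d\<close> by (simp add: c_def add_nonneg_pos)
  then have \<delta>: "0 < \<delta>" using \<open>0 < e\<close> by (simp add: \<delta>_def)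
  have "real N * (\<Sum>j<N. d * \<delta> + 2 * 0) = (c - 1) * \<delta>"
    by (simp add: c_def)
  also have "\<dots> < c * \<delta>" using \<delta> by simp
  also have "\<dots> = e / 2" using \<open>0 < c\<close> by (simp add: \<delta>_def)
  finally have small: "real N * (\<Sum>j<N. d * \<delta> + 2 * 0) < e / 2" .
  have "(\<lambda>n. \<gamma> ^ q + real N * (\<Sum>j<N. d * \<delta> + 2 * p \<delta> (n + j))) \<longlonglongrightarrow>
      \<gamma> ^ q + real N * (\<Sum>j<N. d * \<delta> + 2 * 0)"
    by (intro tendsto_intros LIMSEQ_ignore_initial_segment p \<delta>)
  moreover have "\<gamma> ^ q + real N * (\<Sum>j<N. d * \<delta> + 2 * 0) < e"
    using q small by linarith
  ultimately have "\<forall>\<^sub>F n in sequentially.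
      \<gamma> ^ q + real N * (\<Sum>j<N. d * \<delta> + 2 * p \<delta> (n + j)) < e"
    by (rule order_tendstoD)
  then have "\<forall>\<^sub>F n in sequentially. T (n + N) < e"
    by eventually_elim (use bound[OF \<delta>, of _ q] in \<open>auto simp: N_def intro: le_less_trans\<close>)
  then show "\<forall>\<^sub>F n in sequentially. T n < e"
    using eventually_sequentially_seg[of "\<lambda>n. T n < e" N] by simp
qed

text \<open>The set \<open>Z\<close> of starting values covers both claims: a singleton gives the
  pointwise one, the full product the uniform one. Suprema over \<open>Z\<close> pass through the
  block bound because its constants do not depend on the start.\<close>

lemma adaptive_gibbs_ergodic:
  fixes M :: "'d::finite \<Rightarrow> 'a measure" and Z :: "(('d \<Rightarrow> 'a) \<times> (real^'d)) set"
  assumes \<mu>: "\<mu> \<in> space (prob_algebra (PiM UNIV M))"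
    and cond: "full_conditionals M \<mu> K"
    and "0 < \<epsilon>"
    and rule: "update_rule (PiM UNIV M) (sel_set \<epsilon>) R"
    and \<beta>: "\<beta> \<in> sel_set \<epsilon>" and ue: "uniformly_ergodic \<mu> (rsg M K \<beta>)"
    and Z: "Z \<noteq> {}" "Z \<subseteq> space (PiM UNIV M) \<times> sel_set \<epsilon>"
    and dim: "\<And>\<delta>. 0 < \<delta> \<Longrightarrow> (\<lambda>n. SUP (x0, a0)\<in>Z. adap_change_prob M K R x0 a0 \<delta> n) \<longlonglongrightarrow> 0"
  shows "(\<lambda>n. SUP (x0, a0)\<in>Z. tv_dist (adap_law M K R x0 a0 n) \<mu>) \<longlonglongrightarrow> 0"
proof -
  interpret gibbs_kernels M K
    by unfold_locales (use cond in \<open>simp add: full_conditionals_def\<close>)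
  have sel: "sel_set \<epsilon> \<subseteq> sel_simplex"
    by (simp add: sel_set_def)
  have "\<epsilon> \<le> \<beta> $ i" "\<beta> $ i \<le> 1" for i using \<beta> by (auto simp: sel_set_def)
  then have "\<epsilon> \<le> 1" by (rule order_trans)
  have prob: "prob_space \<mu>" and sets: "sets \<mu> = sets S"
    using \<mu> by (auto simp: space_prob_algebra)
  note P = measurable_rsg_fixed[OF subsetD[OF sel]]
  obtain m where m: "\<And>x. x \<in> space S \<Longrightarrow> tv_dist (kernel_pow S (rsg M K \<beta>) m x) \<mu> \<le> 1 / 4"
    by (rule uniformly_ergodicE[OF ue \<mu>, of "1 / 4"]) auto
  \<comment> \<open>The contraction factor of one block of \<open>m\<close> steps, whose
    minorization constant is \<open>\<epsilon> ^ m\<close>; it is common to all selection vectors in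
    \<open>sel_set \<epsilon>\<close>.\<close>
  define \<gamma> where "\<gamma> = 1 - \<epsilon> ^ m / 2"
  have \<gamma>: "0 \<le> \<gamma>" "\<gamma> < 1"
    using \<open>0 < \<epsilon>\<close> power_le_one[of \<epsilon> m] \<open>\<epsilon> \<le> 1\<close> by (auto simp: \<gamma>_def)
  let ?pr = "\<lambda>\<delta> n (x0, a0). adap_change_prob M K R x0 a0 \<delta> n"
  let ?tv = "\<lambda>n (x0, a0). tv_dist (adap_law M K R x0 a0 n) \<mu>"
  have chain: "adaptive_chain M K (sel_set \<epsilon>) R x0 a0" if "(x0, a0) \<in> Z" for x0 a0
    using that Z sel rule by unfold_locales auto
  have pr_le: "?pr \<delta> n z \<le> 1" if "z \<in> Z" for \<delta> n z
  proof (cases z)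
    case (Pair x0 a0)
    then interpret adaptive_chain M K "sel_set \<epsilon>" R x0 a0 using chain that by simp
    show ?thesis by (simp add: Pair adap_change_prob_def)
  qed
  have law: "prob_space (adap_law M K R x0 a0 n)" if "(x0, a0) \<in> Z" for x0 a0 n
  proof -
    interpret adaptive_chain M K "sel_set \<epsilon>" R x0 a0 using chain that by simp
    show ?thesis unfolding adap_law_def by (rule traj.prob_space_distr[OF measurable_traj(2)])
  qed
  have bound: "tv_dist (adap_law M K R x0 a0 (n + m * q)) \<mu> \<le>
      \<gamma> ^ q + real (m * q) * (\<Sum>j<m * q. real CARD('d) * \<delta> + 2 * adap_change_prob M K R x0 a0 \<delta> (n + j))"
    if z: "(x0, a0) \<in> Z" and \<delta>: "0 < \<delta>" for x0 a0 n q \<delta>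
  proof (rule tv_dist_least)
    interpret adaptive_chain M K "sel_set \<epsilon>" R x0 a0 using chain[OF z] .
    fix A assume "A \<in> sets (adap_law M K R x0 a0 (n + m * q))"
    then have A: "A \<in> sets S" by (simp add: adap_law_def)
    let ?f = "indicator A :: _ \<Rightarrow> real"
    have f: "?f \<in> borel_measurable S" "?f x \<in> {0..1}" for x
      using A by (auto simp: indicator_def)
    have mean: "(\<integral>y. ?f y \<partial>\<rho>) = measure \<rho> A" if "sets \<rho> = sets S" for \<rho>
      using A sets.sets_into_space[OF A] sets_eq_imp_space_eq[OF that] that
      by (simp add: Int_absorb2)
    have conv: "\<bar>(\<integral>y. ?f y \<partial>kernel_pow S (rsg M K a) (m * q) x) - measure \<mu> A\<bar> \<le> \<gamma> ^ q"
      if a: "a \<in> sel_set \<epsilon>" and x: "x \<in> space S" for a x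
      unfolding \<gamma>_def mean[OF sets, symmetric]
      by (rule kernel_pow_geometric_convergence[OF P[OF a] P[OF \<beta>] \<open>0 < \<epsilon>\<close> \<open>\<epsilon> \<le> 1\<close> _ \<mu>
            rsg_stationary[OF \<mu> cond subsetD[OF sel a]] m f x])
        (use a \<beta> \<open>0 < \<epsilon>\<close> in \<open>auto intro!: integral_rsg_minorization\<close>)
    have "measure (adap_law M K R x0 a0 (n + m * q)) A = (\<integral>\<omega>. ?f (\<omega> (n + m * q)) \<partial>traj)"
      using integral_distr[OF measurable_traj(2) f(1)]
      by (simp add: adap_law_def mean[symmetric])
    with integral_law_diff_le[OF f conv less_imp_le[OF \<delta>], of n]
    show "\<bar>measure (adap_law M K R x0 a0 (n + m * q)) A - measure \<mu> A\<bar> \<le>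
        \<gamma> ^ q + real (m * q) * (\<Sum>j<m * q. real CARD('d) * \<delta> + 2 * adap_change_prob M K R x0 a0 \<delta> (n + j))"
      by simp
  qed
  \<comment> \<open>Suprema of reals dominate their members only over sets bounded above.\<close>
  have pr_bdd: "bdd_above (?pr \<delta> n ` Z)" for \<delta> n
    using pr_le by (rule bdd_aboveI2)
  have tv_bdd: "bdd_above (?tv n ` Z)" for n
  proof (rule bdd_aboveI2)
    fix z assume "z \<in> Z"
    then obtain x0 a0 where z: "z = (x0, a0)" "(x0, a0) \<in> Z" by (cases z) auto
    have "\<bar>measure (adap_law M K R x0 a0 n) A - measure \<mu> A\<bar> \<le> 1" for A
      using prob_space.prob_le_1[OF law[OF z(2)], of n A] prob_space.prob_le_1[OF prob, of A]
        measure_nonneg[of "adap_law M K R x0 a0 n" A] measure_nonneg[of \<mu> A] by linarith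
    then show "?tv n z \<le> 1" unfolding z by (auto intro: tv_dist_least)
  qed
  show ?thesis
  proof (rule tendsto_zero_of_block_bound[OF _ \<gamma> _ _ dim, where d="real CARD('d)" and m=m])
    show "0 \<le> (SUP z\<in>Z. ?tv n z)" for n
    proof -
      obtain x0 a0 where z: "(x0, a0) \<in> Z" using Z by auto
      have "0 \<le> ?tv n (x0, a0)" using tv_dist_nonneg[OF law[OF z] prob] by simp
      also have "\<dots> \<le> (SUP z\<in>Z. ?tv n z)" by (rule cSUP_upper[OF z tv_bdd])
      finally show ?thesis .
    qed
    fix n q and \<delta> :: real assume \<delta>: "0 < \<delta>"
    show "(SUP z\<in>Z. ?tv (n + m * q) z) \<le>
        \<gamma> ^ q + real (m * q) * (\<Sum>j<m * q. real CARD('d) * \<delta> + 2 * (SUP z\<in>Z. ?pr \<delta> (n + j) z))"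
    proof (rule cSUP_least[OF Z(1)])
      fix z assume "z \<in> Z"
      then obtain x0 a0 where z: "z = (x0, a0)" "(x0, a0) \<in> Z" by (cases z) auto
      have "adap_change_prob M K R x0 a0 \<delta> k \<le> (SUP z\<in>Z. ?pr \<delta> k z)" for k
        using cSUP_upper[OF z(2) pr_bdd, of \<delta> k] by simp
      then have "real (m * q) * (\<Sum>j<m * q. real CARD('d) * \<delta> + 2 * adap_change_prob M K R x0 a0 \<delta> (n + j)) \<le>
          real (m * q) * (\<Sum>j<m * q. real CARD('d) * \<delta> + 2 * (SUP z\<in>Z. ?pr \<delta> (n + j) z))"
        by (intro mult_left_mono sum_mono add_left_mono) simp_all
      with bound[OF z(2) \<delta>, of n q] show "?tv (n + m * q) z \<le>
          \<gamma> ^ q + real (m * q) * (\<Sum>j<m * q. real CARD('d) * \<delta> + 2 * (SUP z\<in>Z. ?pr \<delta> (n + j) z))"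
        unfolding z by simp
    qed
  qed simp_all
qed

theorem theorem4p1:
  fixes M :: "'d::finite \<Rightarrow> 'a measure"
    and \<pi> :: "('d \<Rightarrow> 'a) measure"
    and K :: "'d \<Rightarrow> ('d \<Rightarrow> 'a) \<Rightarrow> 'a measure"
    and \<epsilon> :: real
    and R :: "nat \<Rightarrow> real^'d \<Rightarrow> (nat \<Rightarrow> 'd \<Rightarrow> 'a) \<Rightarrow> real^'d"
  assumes pi_sets: "sets \<pi> = sets (PiM UNIV M)"
    and pi_prob: "prob_space \<pi>"
    and cond: "full_conditionals M \<pi> K"
    and eps: "0 < \<epsilon>" "\<epsilon> \<le> 1 / real CARD('d)"
    and rule: "update_rule (PiM UNIV M) (sel_set \<epsilon>) R"
    and b: "\<exists>\<beta>\<in>sel_set \<epsilon>. uniformly_ergodic \<pi> (rsg M K \<beta>)"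
  shows "(\<forall>x0\<in>space (PiM UNIV M). \<forall>a0\<in>sel_set \<epsilon>.
            (\<forall>\<delta>>0. (\<lambda>n. adap_change_prob M K R x0 a0 \<delta> n) \<longlonglongrightarrow> 0) \<longrightarrow>
            (\<lambda>n. tv_dist (adap_law M K R x0 a0 n) \<pi>) \<longlonglongrightarrow> 0) \<and>
         ((\<forall>\<delta>>0. (\<lambda>n. SUP (x0, a0)\<in>space (PiM UNIV M) \<times> sel_set \<epsilon>.
                     adap_change_prob M K R x0 a0 \<delta> n) \<longlonglongrightarrow> 0) \<longrightarrow>
          (\<lambda>n. SUP (x0, a0)\<in>space (PiM UNIV M) \<times> sel_set \<epsilon>.
                 tv_dist (adap_law M K R x0 a0 n) \<pi>) \<longlonglongrightarrow> 0)"
proof -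
  from b obtain \<beta> where \<beta>: "\<beta> \<in> sel_set \<epsilon>" "uniformly_ergodic \<pi> (rsg M K \<beta>)" by blast
  have \<pi>: "\<pi> \<in> space (prob_algebra (PiM UNIV M))"
    using pi_sets pi_prob by (simp add: space_prob_algebra)
  note ergodic = adaptive_gibbs_ergodic[OF \<pi> cond eps(1) rule \<beta>]
  \<comment> \<open>The supremum must range over a nonempty set: the state space carries a
    probability measure, and \<open>\<beta>\<close> supplies a selection vector.\<close>
  obtain x where x: "x \<in> space (PiM UNIV M)"
    using prob_space.not_empty[OF pi_prob] unfolding sets_eq_imp_space_eq[OF pi_sets]
    by (meson all_not_in_conv)
  have ne: "space (PiM UNIV M) \<times> (sel_set \<epsilon> :: (real^'d) set) \<noteq> {}"
    using SigmaI[OF x \<beta>(1)] by blast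
  show ?thesis
  proof (intro conjI ballI impI)
    fix x0 a0
    assume "x0 \<in> space (PiM UNIV M)" "a0 \<in> sel_set \<epsilon>"
      and "\<forall>\<delta>>0. (\<lambda>n. adap_change_prob M K R x0 a0 \<delta> n) \<longlonglongrightarrow> 0"
    then show "(\<lambda>n. tv_dist (adap_law M K R x0 a0 n) \<pi>) \<longlonglongrightarrow> 0"
      \<comment> \<open>Over a singleton both suprema collapse to their only member.\<close>
      using ergodic[of "{(x0, a0)}"] by simp
  next
    assume "\<forall>\<delta>>0. (\<lambda>n. SUP (x0, a0)\<in>space (PiM UNIV M) \<times> sel_set \<epsilon>.
      adap_change_prob M K R x0 a0 \<delta> n) \<longlonglongrightarrow> 0"
    then show "(\<lambda>n. SUP (x0, a0)\<in>space (PiM UNIV M) \<times> sel_set \<epsilon>.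
        tv_dist (adap_law M K R x0 a0 n) \<pi>) \<longlonglongrightarrow> 0"
      by (intro ergodic ne subset_refl) simp
  qed
qed

end
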